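(* Let $K, L\subset\mathbb{R}^2$ be two smooth, strictly convex planar convex bodies, each containing the origin in its interior. If $K$ and $L$ are at a dilation position and have the same cone-volume measure, i.e. $V_K=V_L$ as Borel measures on $\mathbb{S}^1$, then $K=L$.
   Context: A convex body in $\mathbb{R}^n$ is a compact convex subset with non-empty interior. The support function of $K$ is $h_K(x)=\max\{x\cdot y: y\in K\}$. Cone-volume measure: for a convex body $K\subset\mathbb{R}^n$ containing the origin in its interior, $V_K$ is the Borel measure on the unit sphere $\mathbb{S}^{n-1}$ with $dV_K=\frac1n h_K\,dS_K$, where $S_K$ is the surface area measure of $K$. Dilation position: $K$ and $L$ are at a dilation position if the origin $o\in K\cap L$ and $r(K,L)\,L\subset K\subset R(K,L)\,L$, where $r(K,L)=\max\{t>0: x+tL\subset K \text{ for some } x\in\mathbb{R}^n\}$ and $R(K,L)=\min\{t>0: x+tL\supset K\text{ for some }x\in\mathbb{R}^n\}$. *)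

theory Defs
  imports "HOL-Analysis.Analysis"
begin

definition convex_body :: "'a::euclidean_space set \<Rightarrow> bool" where
  "convex_body K \<longleftrightarrow> compact K \<and> convex K \<and> interior K \<noteq> {}"

text \<open>On a non-empty compact set the supremum below is attained, so it is the maximum.\<close>

definition support_fun :: "'a::euclidean_space set \<Rightarrow> 'a \<Rightarrow> real" where
  "support_fun K x = (SUP y\<in>K. x \<bullet> y)"

definition outer_unit_normal :: "'a::euclidean_space set \<Rightarrow> 'a \<Rightarrow> 'a \<Rightarrow> bool" where
  "outer_unit_normal K x u \<longleftrightarrow> norm u = 1 \<and> (\<forall>y\<in>K. u \<bullet> y \<le> u \<bullet> x)"

text \<open>Smoothness is meant in the sense of convex geometry: exactly one supporting hyperplane
  (equivalently, exactly one outer unit normal) at each boundary point.\<close>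

definition smooth_body :: "'a::euclidean_space set \<Rightarrow> bool" where
  "smooth_body K \<longleftrightarrow> (\<forall>x\<in>frontier K. \<exists>!u. outer_unit_normal K x u)"

definition strictly_convex :: "'a::euclidean_space set \<Rightarrow> bool" where
  "strictly_convex K \<longleftrightarrow> (\<forall>x\<in>K. \<forall>y\<in>K. x \<noteq> y \<longrightarrow> open_segment x y \<subseteq> interior K)"

text \<open>The \<open>m\<close>-dimensional Hausdorff outer measure, normalised so that it agrees with
  Lebesgue measure on \<open>m\<close>-dimensional subspaces; for \<open>m = 1\<close> the weight of a covering set
  is just its diameter. The library function \<^const>\<open>diameter\<close> is meaningful for bounded sets
  only, and the empty set is given weight \<open>0\<close> also when \<open>m = 0\<close>.\<close>

definition hausdorff_weight :: "nat \<Rightarrow> 'a::metric_space set \<Rightarrow> ennreal" where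
  "hausdorff_weight m U =
     (if U = {} then 0 else ennreal (unit_ball_vol (real m) * (diameter U / 2) ^ m))"

definition hausdorff_premeasure :: "nat \<Rightarrow> real \<Rightarrow> 'a::metric_space set \<Rightarrow> ennreal" where
  "hausdorff_premeasure m \<delta> A =
     (INF U\<in>{U :: nat \<Rightarrow> 'a set. A \<subseteq> (\<Union>i. U i) \<and> (\<forall>i. bounded (U i) \<and> diameter (U i) \<le> \<delta>)}.
        (\<Sum>i. hausdorff_weight m (U i)))"

definition hausdorff_outer_measure :: "nat \<Rightarrow> 'a::metric_space set \<Rightarrow> ennreal" where
  "hausdorff_outer_measure m A = (SUP \<delta>\<in>{0<..}. hausdorff_premeasure m \<delta> A)"

text \<open>\<open>reverse_spherical_image K \<omega>\<close> is the preimage of \<open>\<omega>\<close> under the (in general multivalued)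
  Gauss map of \<open>K\<close>. For every convex body, its \<open>(n - 1)\<close>-dimensional Hausdorff measure is
  countably additive in the Borel set \<open>\<omega>\<close>, because the boundary points with more than one
  outer unit normal form a null set. Hence \<^const>\<open>measure_of\<close> below does not fall back to
  its default, the null measure.\<close>

definition reverse_spherical_image :: "'a::euclidean_space set \<Rightarrow> 'a set \<Rightarrow> 'a set" where
  "reverse_spherical_image K \<omega> = {x \<in> frontier K. \<exists>u\<in>\<omega>. outer_unit_normal K x u}"

definition surface_area_measure :: "'a::euclidean_space set \<Rightarrow> 'a measure" where
  "surface_area_measure K =
     measure_of (sphere 0 1) (sets (restrict_space borel (sphere 0 1)))
       (\<lambda>\<omega>. hausdorff_outer_measure (DIM('a) - 1) (reverse_spherical_image K \<omega>))"

definition cone_volume_measure :: "'a::euclidean_space set \<Rightarrow> 'a measure" where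
  "cone_volume_measure K =
     density (surface_area_measure K) (\<lambda>u. ennreal (support_fun K u / real DIM('a)))"

text \<open>For convex bodies the supremum and the infimum below are attained (by compactness), so they
  are the maximum and the minimum.\<close>

definition rel_inradius :: "'a::euclidean_space set \<Rightarrow> 'a set \<Rightarrow> real" where
  "rel_inradius K L = Sup {t. t > 0 \<and> (\<exists>x. (\<lambda>y. x + t *\<^sub>R y) ` L \<subseteq> K)}"

definition rel_circumradius :: "'a::euclidean_space set \<Rightarrow> 'a set \<Rightarrow> real" where
  "rel_circumradius K L = Inf {t. t > 0 \<and> (\<exists>x. K \<subseteq> (\<lambda>y. x + t *\<^sub>R y) ` L)}"

definition dilation_position :: "'a::euclidean_space set \<Rightarrow> 'a set \<Rightarrow> bool" where
  "dilation_position K L \<longleftrightarrow>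
     0 \<in> K \<inter> L \<and>
     (\<lambda>y. rel_inradius K L *\<^sub>R y) ` L \<subseteq> K \<and>
     K \<subseteq> (\<lambda>y. rel_circumradius K L *\<^sub>R y) ` L"

end

theory Submission
  imports Defs
begin

text \<open>Let \<open>h\<^sub>K, h\<^sub>L\<close> be the support functions on the circle, \<open>V\<close> the common total cone volume
  and \<open>W\<close> the mixed area. In a dilation position \<open>h\<^sub>K - t h\<^sub>L\<close> is nonnegative for
  the relative inradius \<open>t = r\<close> and nonpositive for the relative circumradius \<open>t = R\<close>, and its
  zeros meet every closed half circle, as otherwise a translate of a larger (smaller) homothet of
  \<open>L\<close> would fit inside (around) \<open>K\<close>. Wirtinger's inequality between consecutive zeros gives
  \<open>V - 2 t W + t\<^sup>2 V \<le> 0\<close> for \<open>t = r\<close> and \<open>t = R\<close>, hence for all \<open>t\<close> between them, in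
  particular for \<open>t = h\<^sub>K(u) / h\<^sub>L(u)\<close>. Dividing by \<open>t\<close> and integrating against
  \<open>V\<^sub>K = V\<^sub>L\<close> yields \<open>V W - 2 W V + V W = 0\<close>, because \<open>t\<^sup>-\<^sup>1 dV\<^sub>K = h\<^sub>L dS\<^sub>K / 2\<close> and
  \<open>t dV\<^sub>L = h\<^sub>K dS\<^sub>L / 2\<close> both have total mass \<open>W\<close>. So \<open>h\<^sub>K / h\<^sub>L\<close> takes values among the roots of a
  fixed quadratic polynomial; by continuity it is constant, and the constant is \<open>1\<close>.

  The surface area measure is reached through the arc length parametrisation of the boundary. As
  the boundary is a \<open>C\<^sup>1\<close> curve, this parametrisation is almost isometric at small scales, so it
  carries Lebesgue measure to Hausdorff measure.\<close>

subsection \<open>One-dimensional Hausdorff measure of curves\<close>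

lemma hausdorff_weight_1: "hausdorff_weight 1 U = ennreal (diameter U)"
  by (simp add: hausdorff_weight_def unit_ball_vol_1 diameter_empty)

lemma hausdorff_premeasure_mono: "A \<subseteq> B \<Longrightarrow> hausdorff_premeasure m \<delta> A \<le> hausdorff_premeasure m \<delta> B"
  unfolding hausdorff_premeasure_def by (rule INF_superset_mono) auto

lemma hausdorff_outer_measure_mono:
  "A \<subseteq> B \<Longrightarrow> hausdorff_outer_measure m A \<le> hausdorff_outer_measure m B"
  unfolding hausdorff_outer_measure_def by (intro SUP_mono) (blast intro: hausdorff_premeasure_mono)

text \<open>A derivative-free, uniform form of unit speed and continuous differentiability. The
  scale \<open>\<eta>\<close> does not depend on the base point, as the covering arguments below
  require.\<close>

definition near_isometry_on :: "'a::metric_space set \<Rightarrow> ('a \<Rightarrow> 'b::metric_space) \<Rightarrow> bool" where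
  "near_isometry_on S f \<longleftrightarrow> (\<forall>\<epsilon>>0. \<exists>\<eta>>0. \<forall>s\<in>S. \<forall>t\<in>S. dist s t < \<eta> \<longrightarrow>
     (1 - \<epsilon>) * dist s t \<le> dist (f s) (f t) \<and> dist (f s) (f t) \<le> (1 + \<epsilon>) * dist s t)"

lemma near_isometry_onD:
  assumes "near_isometry_on S f" "0 < \<epsilon>"
  obtains \<eta> where "0 < \<eta>"
    "\<And>s t. \<lbrakk>s \<in> S; t \<in> S; dist s t < \<eta>\<rbrakk> \<Longrightarrow> (1 - \<epsilon>) * dist s t \<le> dist (f s) (f t)"
    "\<And>s t. \<lbrakk>s \<in> S; t \<in> S; dist s t < \<eta>\<rbrakk> \<Longrightarrow> dist (f s) (f t) \<le> (1 + \<epsilon>) * dist s t"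
  using assms unfolding near_isometry_on_def by meson

lemma near_isometry_on_subset: "near_isometry_on S f \<Longrightarrow> T \<subseteq> S \<Longrightarrow> near_isometry_on T f"
  unfolding near_isometry_on_def by (meson subsetD)

lemma near_isometry_on_imp_continuous_on:
  assumes "near_isometry_on S f" shows "continuous_on S f"
  unfolding continuous_on_iff
proof safe
  fix x e :: real and x' assume "x' \<in> S" "0 < e"
  obtain \<eta> where \<eta>: "\<eta> > 0" "\<And>s t. \<lbrakk>s \<in> S; t \<in> S; dist s t < \<eta>\<rbrakk> \<Longrightarrow> dist (f s) (f t) \<le> 2 * dist s t"
    using near_isometry_onD[OF assms, of 1] by auto
  have "dist (f y) (f x') < e" if "y \<in> S" "dist y x' < min \<eta> (e/2)" for y
    using \<eta>(2)[OF that(1) \<open>x' \<in> S\<close>] that by auto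
  then show "\<exists>d>0. \<forall>y\<in>S. dist y x' < d \<longrightarrow> dist (f y) (f x') < e"
    using \<eta>(1) \<open>0 < e\<close> by (intro exI[of _ "min \<eta> (e/2)"]) auto
qed

text \<open>Every fine cover of the image pulls back to a cover of \<open>B\<close> whose pieces lie
  in intervals only slightly longer than the diameters of the covering sets. Countable subadditivity
  of Lebesgue measure then bounds \<open>B\<close>, and letting \<open>\<epsilon>\<close> tend to 0
  removes the distortion.\<close>

lemma hausdorff_ge_lborel:
  fixes f :: "real \<Rightarrow> 'a::metric_space"
  assumes iso: "near_isometry_on {c..d} f" and inj: "inj_on f {c..d}"
    and B: "B \<subseteq> {c..d}" "B \<in> sets borel"
  shows "emeasure lborel B \<le> hausdorff_outer_measure 1 (f ` B)"
proof -
  have "ennreal (1 - \<epsilon>) * emeasure lborel B \<le> hausdorff_outer_measure 1 (f ` B)"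
    if \<epsilon>: "0 < \<epsilon>" "\<epsilon> < 1" for \<epsilon>
  proof -
    obtain \<eta> where \<eta>: "0 < \<eta>"
      "\<And>s t. \<lbrakk>s \<in> {c..d}; t \<in> {c..d}; dist s t < \<eta>\<rbrakk> \<Longrightarrow> (1 - \<epsilon>) * dist s t \<le> dist (f s) (f t)"
      using near_isometry_onD[OF iso \<epsilon>(1)] by metis
    obtain g where g: "\<And>x. x \<in> {c..d} \<Longrightarrow> g (f x) = x"
      using inj by (metis the_inv_into_f_f)
    have cf: "continuous_on {c..d} f" by (rule near_isometry_on_imp_continuous_on[OF iso])
    \<comment> \<open>The lower distance bound holds only for parameters closer than
      \<open>\<eta>\<close>. Compactness makes the inverse uniformly continuous, so image points in
      one small covering set do have such parameters.\<close>
    have "continuous_on (f ` {c..d}) g"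
      using g by (intro continuous_on_inv cf) auto
    then have "uniformly_continuous_on (f ` {c..d}) g"
      by (intro compact_uniformly_continuous compact_continuous_image cf) auto
    then obtain \<delta>0 where \<delta>0: "\<delta>0 > 0"
      "\<And>x y. \<lbrakk>x \<in> f ` {c..d}; y \<in> f ` {c..d}; dist x y < \<delta>0\<rbrakk> \<Longrightarrow> dist (g x) (g y) < \<eta>"
      unfolding uniformly_continuous_on_def using \<eta>(1) by (metis dist_commute)
    \<comment> \<open>Halved because covers satisfy only
      \<open>diameter (U i) \<le> \<delta>\<close>, while uniform continuity asks for a strict
      inequality.\<close>
    define \<delta> where "\<delta> = \<delta>0 / 2"
    have \<delta>: "\<delta> > 0" "\<And>s t. \<lbrakk>s \<in> {c..d}; t \<in> {c..d}; dist (f s) (f t) \<le> \<delta>\<rbrakk> \<Longrightarrow> dist s t < \<eta>"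
    proof -
      show "\<delta> > 0" using \<delta>0(1) by (simp add: \<delta>_def)
      fix s t assume st: "s \<in> {c..d}" "t \<in> {c..d}" "dist (f s) (f t) \<le> \<delta>"
      then have "dist (f s) (f t) < \<delta>0" using \<delta>0(1) by (simp add: \<delta>_def)
      then show "dist s t < \<eta>" using \<delta>0(2)[of "f s" "f t"] st(1,2) g by auto
    qed
    have "ennreal (1 - \<epsilon>) * emeasure lborel B \<le> hausdorff_premeasure 1 \<delta> (f ` B)"
      unfolding hausdorff_premeasure_def
    proof (rule INF_greatest, clarify)
      fix U :: "nat \<Rightarrow> 'a set"
      assume U: "f ` B \<subseteq> (\<Union>i. U i)" "\<forall>i. bounded (U i) \<and> diameter (U i) \<le> \<delta>"
      define r where "r i = diameter (U i) / (1 - \<epsilon>)" for i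
      have r0: "r i \<ge> 0" for i using U(2) \<epsilon> by (simp add: r_def diameter_ge_0)
      \<comment> \<open>Two points of a pulled-back piece are at most \<open>r i\<close> apart, so
        the interval of length \<open>r i\<close> starting at its infimum contains it.\<close>
      have "\<exists>p. {s\<in>B. f s \<in> U i} \<subseteq> {p..p + r i}" for i
      proof (cases "{s\<in>B. f s \<in> U i} = {}")
        case False
        have close: "\<bar>s - t\<bar> \<le> r i" if "s \<in> B" "t \<in> B" "f s \<in> U i" "f t \<in> U i" for s t
        proof -
          have le: "dist (f s) (f t) \<le> diameter (U i)"
            using U(2) that by (simp add: diameter_bounded_bound)
          then have "dist (f s) (f t) \<le> \<delta>" using U(2) by (meson order_trans)
          then have "(1 - \<epsilon>) * dist s t \<le> dist (f s) (f t)"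
            using \<delta>(2) \<eta>(2) that B by blast
          then show ?thesis using le \<epsilon> by (simp add: r_def field_simps dist_real_def)
        qed
        have bb: "bdd_below {s\<in>B. f s \<in> U i}" using B(1) by (intro bdd_belowI[of _ c]) auto
        have "{s\<in>B. f s \<in> U i} \<subseteq> {Inf {s\<in>B. f s \<in> U i}..Inf {s\<in>B. f s \<in> U i} + r i}"
        proof
          fix s assume s: "s \<in> {s\<in>B. f s \<in> U i}"
          have "s - r i \<le> Inf {s\<in>B. f s \<in> U i}"
            using False close s by (intro cInf_greatest) (auto simp: abs_le_iff algebra_simps)
          then show "s \<in> {Inf {s\<in>B. f s \<in> U i}..Inf {s\<in>B. f s \<in> U i} + r i}"
            using cInf_lower[OF s bb] by simp
        qed
        then show ?thesis by blast
      qed auto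
      then obtain p where p: "\<And>i. {s\<in>B. f s \<in> U i} \<subseteq> {p i..p i + r i}" by metis
      have "B \<subseteq> (\<Union>i. {p i..p i + r i})" using U(1) p by blast
      then have "emeasure lborel B \<le> emeasure lborel (\<Union>i. {p i..p i + r i})"
        by (intro emeasure_mono) auto
      also have "\<dots> \<le> (\<Sum>i. emeasure lborel {p i..p i + r i})"
        by (intro emeasure_subadditive_countably) auto
      also have "\<dots> = (\<Sum>i. ennreal (r i))" using r0 by simp
      finally have "ennreal (1 - \<epsilon>) * emeasure lborel B \<le> ennreal (1 - \<epsilon>) * (\<Sum>i. ennreal (r i))"
        by (rule mult_left_mono) simp
      also have "\<dots> = (\<Sum>i. ennreal (1 - \<epsilon>) * ennreal (r i))" by simp
      also have "\<dots> = (\<Sum>i. hausdorff_weight 1 (U i))"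
        unfolding hausdorff_weight_1 using \<epsilon> r0
        by (intro suminf_cong) (simp add: r_def ennreal_mult'[symmetric])
      finally show "ennreal (1 - \<epsilon>) * emeasure lborel B \<le> (\<Sum>i. hausdorff_weight 1 (U i))" .
    qed
    also have "\<dots> \<le> hausdorff_outer_measure 1 (f ` B)"
      unfolding hausdorff_outer_measure_def using \<delta>(1) by (intro SUP_upper) auto
    finally show ?thesis .
  qed
  note * = this
  have "((\<lambda>\<epsilon>. ennreal (1 - \<epsilon>) * emeasure lborel B) \<longlongrightarrow> ennreal (1 - 0) * emeasure lborel B) (at_right 0)"
  proof (rule tendsto_mult_ennreal)
    show "((\<lambda>\<epsilon>. ennreal (1 - \<epsilon>)) \<longlongrightarrow> ennreal (1 - 0)) (at_right 0)"
      by (intro tendsto_ennrealI tendsto_intros)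
  qed simp_all
  moreover have "\<forall>\<^sub>F \<epsilon> in at_right 0. ennreal (1 - \<epsilon>) * emeasure lborel B \<le> hausdorff_outer_measure 1 (f ` B)"
    unfolding eventually_at_right_field using * by (intro exI[of _ 1]) auto
  ultimately have "ennreal (1 - 0) * emeasure lborel B \<le> hausdorff_outer_measure 1 (f ` B)"
    by (rule tendsto_upperbound) (rule trivial_limit_at_right_real)
  then show ?thesis by simp
qed

text \<open>An open superset of \<open>B\<close> with little excess measure contains short
  non-overlapping intervals that cover \<open>B\<close>. Their images form an admissible cover whose
  diameters exceed the interval lengths by a factor of at most
  \<open>1 + \<epsilon>\<close>.\<close>

lemma hausdorff_le_lborel:
  fixes f :: "real \<Rightarrow> 'a::metric_space"
  assumes iso: "near_isometry_on {a..b} f" and ab: "a < b"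
    and B: "B \<subseteq> {a..b}" "B \<in> sets borel"
  shows "hausdorff_outer_measure 1 (f ` B) \<le> emeasure lborel B"
proof -
  have main: "hausdorff_premeasure 1 \<delta> (f ` B) \<le> ennreal (1 + \<epsilon>) * (emeasure lborel B + ennreal \<epsilon>)"
    if \<delta>: "\<delta> > 0" and \<epsilon>: "\<epsilon> > 0" for \<delta> \<epsilon>
  proof -
    obtain \<eta> where \<eta>: "0 < \<eta>"
      "\<And>s t. \<lbrakk>s \<in> {a..b}; t \<in> {a..b}; dist s t < \<eta>\<rbrakk> \<Longrightarrow> dist (f s) (f t) \<le> (1 + \<epsilon>) * dist s t"
      using near_isometry_onD[OF iso \<epsilon>(1)] by metis
    obtain O' where O': "open O'" "B \<subseteq> O'" "emeasure lborel (O' - B) < ennreal \<epsilon>"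
      using outer_regular_lborel[OF B(2) \<epsilon>] by metis
    \<comment> \<open>An interval in a ball of radius \<open>\<rho>\<close> is shorter than
      \<open>\<eta>\<close>, so the upper distance bound applies, and its image has diameter at most
      \<open>\<delta>\<close>.\<close>
    define \<rho> where "\<rho> = min (\<eta> / 2) (\<delta> / (2 * (1 + \<epsilon>)))"
    have \<rho>: "\<rho> > 0" "2 * \<rho> \<le> \<eta>" "(1 + \<epsilon>) * (2 * \<rho>) \<le> \<delta>"
    proof -
      show "\<rho> > 0" "2 * \<rho> \<le> \<eta>" using \<eta>(1) \<delta> \<epsilon> by (auto simp: \<rho>_def)
      have "\<rho> \<le> \<delta> / (2 * (1 + \<epsilon>))" by (simp add: \<rho>_def)
      then show "(1 + \<epsilon>) * (2 * \<rho>) \<le> \<delta>" using \<epsilon> by (simp add: field_simps)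
    qed
    \<comment> \<open>The gauge forces each covering interval, tagged at a point of
      \<open>B\<close>, into both \<open>O'\<close> and a small ball.\<close>
    define g where "g x = (if x \<in> O' then O' \<inter> ball x \<rho> else ball x \<rho>)" for x
    have "gauge g" using O'(1) \<rho>(1) by (auto simp: gauge_def g_def)
    obtain \<D> where D: "countable \<D>" "\<And>K. K \<in> \<D> \<Longrightarrow> interior K \<noteq> {} \<and> (\<exists>c d. K = cbox c d)"
      "pairwise (\<lambda>A B. interior A \<inter> interior B = {}) \<D>"
      "\<And>K. K \<in> \<D> \<Longrightarrow> \<exists>x \<in> B \<inter> K. K \<subseteq> g x" "B \<subseteq> \<Union>\<D>"

    proof (rule covering_lemma[of B a b g])
      show "B \<subseteq> cbox a b" "box a b \<noteq> {}" "gauge g" using B(1) ab \<open>gauge g\<close> by (auto simp: box_real)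
    qed blast
    \<comment> \<open>\<open>\<D>\<close> may be finite, whereas a cover is a sequence: the members
      are numbered by the set \<open>I\<close>, and all other indices get the empty set.\<close>
    define I where "I = to_nat_on \<D> ` \<D>"
    define c where "c = from_nat_into \<D>"
    have c_in: "c i \<in> \<D>" if "i \<in> I" for i
      using that D(1) by (auto simp: I_def c_def)
    have c_inj: "c i = c j \<Longrightarrow> i = j" if "i \<in> I" "j \<in> I" for i j
      using that D(1) by (auto simp: I_def c_def)
    have c_onto: "\<exists>i\<in>I. K = c i" if "K \<in> \<D>" for K
      using that D(1) by (auto simp: I_def c_def)
    define U where "U i = (if i \<in> I then f ` (c i \<inter> {a..b}) else {})" for i
    \<comment> \<open>The intervals may share endpoints. Their interiors are disjoint and have the
      same lengths, so the lengths add up to at most the measure of \<open>O'\<close>.\<close>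
    define V where "V i = (if i \<in> I then interior (c i) else {})" for i
    have bdd: "bounded (f ` {a..b})"
      by (intro compact_imp_bounded compact_continuous_image near_isometry_on_imp_continuous_on iso) auto
    have "f ` B \<subseteq> (\<Union>i. U i)"
    proof
      fix y assume "y \<in> f ` B"
      then obtain s where s: "s \<in> B" "y = f s" by auto
      then obtain K where "K \<in> \<D>" "s \<in> K" using D(5) by auto
      then obtain i where "i \<in> I" "s \<in> c i" using c_onto by blast
      then show "y \<in> (\<Union>i. U i)" using s B(1) by (auto simp: U_def intro!: exI[of _ i])
    qed
    moreover have Ui: "bounded (U i)" "diameter (U i) \<le> \<delta>"
      "ennreal (diameter (U i)) \<le> ennreal (1 + \<epsilon>) * emeasure lborel (V i)" "V i \<subseteq> O'" for i
    proof -
      have "bounded (U i) \<and> diameter (U i) \<le> \<delta> \<and>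
        ennreal (diameter (U i)) \<le> ennreal (1 + \<epsilon>) * emeasure lborel (V i) \<and> V i \<subseteq> O'"
      proof (cases "i \<in> I")
        case True
        obtain p q where pq: "c i = {p..q}" using D(2)[OF c_in[OF True]] by auto
        have "{p<..<q} \<noteq> {}" using D(2)[OF c_in[OF True]] by (simp add: pq)
        then have "p < q" by simp
        obtain x where x: "x \<in> B" "c i \<subseteq> g x" using D(4)[OF c_in[OF True]] by blast
        have sub: "c i \<subseteq> ball x \<rho>" "c i \<subseteq> O'"
        proof -
          have "c i \<subseteq> O' \<inter> ball x \<rho>" using x O'(2) by (simp add: g_def subset_iff)
          then show "c i \<subseteq> ball x \<rho>" "c i \<subseteq> O'" by auto
        qed
        have bd: "dist (f s) (f t) \<le> (1 + \<epsilon>) * dist s t \<and> dist s t \<le> 2 * \<rho> \<and> dist s t \<le> q - p"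
          if "s \<in> c i \<inter> {a..b}" "t \<in> c i \<inter> {a..b}" for s t
        proof -
          have "dist x s < \<rho>" "dist x t < \<rho>" using that sub by auto
          then have "dist s t < 2 * \<rho>" by (simp add: dist_real_def)
          then show ?thesis using that \<rho>(2) \<eta>(2)[of s t] by (auto simp: pq dist_real_def)
        qed
        have ne: "U i \<noteq> {}" using x D(4)[OF c_in[OF True]] B(1) by (auto simp: U_def True)
        have dl: "diameter (U i) \<le> e" if "\<And>s t. \<lbrakk>s \<in> c i \<inter> {a..b}; t \<in> c i \<inter> {a..b}\<rbrakk> \<Longrightarrow> dist (f s) (f t) \<le> e" for e
          using ne that by (subst diameter_def) (auto simp: U_def True intro!: cSUP_least)
        have "diameter (U i) \<le> (1 + \<epsilon>) * (2 * \<rho>)"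
        proof (rule dl)
          fix s t assume "s \<in> c i \<inter> {a..b}" "t \<in> c i \<inter> {a..b}"
          note b = bd[OF this]
          show "dist (f s) (f t) \<le> (1 + \<epsilon>) * (2 * \<rho>)"
            using b \<epsilon> by (intro order_trans[OF conjunct1[OF b]] mult_left_mono) auto
        qed
        moreover have "diameter (U i) \<le> (1 + \<epsilon>) * (q - p)"
        proof (rule dl)
          fix s t assume "s \<in> c i \<inter> {a..b}" "t \<in> c i \<inter> {a..b}"
          note b = bd[OF this]
          show "dist (f s) (f t) \<le> (1 + \<epsilon>) * (q - p)"
            using b \<epsilon> by (intro order_trans[OF conjunct1[OF b]] mult_left_mono) auto
        qed
        moreover have "emeasure lborel (V i) = ennreal (q - p)"
          using \<open>p < q\<close> by (simp add: V_def True pq)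
        moreover have "bounded (U i)" using bdd by (rule bounded_subset) (auto simp: U_def)
        moreover have "V i \<subseteq> O'" using order_trans[OF interior_subset sub(2)] by (simp add: V_def True)
        moreover have "ennreal (1 + \<epsilon>) * ennreal (q - p) = ennreal ((1 + \<epsilon>) * (q - p))"
          using \<epsilon> \<open>p < q\<close> by (intro ennreal_mult[symmetric]) auto
        ultimately show ?thesis using \<rho>(3) by (simp add: ennreal_leI)
      qed (use \<delta> in \<open>auto simp: U_def V_def\<close>)
      then show "bounded (U i)" "diameter (U i) \<le> \<delta>"
        "ennreal (diameter (U i)) \<le> ennreal (1 + \<epsilon>) * emeasure lborel (V i)" "V i \<subseteq> O'" by auto
    qed
    ultimately have "U \<in> {U. f ` B \<subseteq> (\<Union>i. U i) \<and> (\<forall>i. bounded (U i) \<and> diameter (U i) \<le> \<delta>)}"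
      by simp
    then have "hausdorff_premeasure 1 \<delta> (f ` B) \<le> (\<Sum>i. hausdorff_weight 1 (U i))"
      unfolding hausdorff_premeasure_def by (rule INF_lower)
    also have "\<dots> \<le> (\<Sum>i. ennreal (1 + \<epsilon>) * emeasure lborel (V i))"
      unfolding hausdorff_weight_1 by (intro suminf_le Ui) auto
    also have "\<dots> = ennreal (1 + \<epsilon>) * (\<Sum>i. emeasure lborel (V i))" by simp
    also have "(\<Sum>i. emeasure lborel (V i)) = emeasure lborel (\<Union>i. V i)"
    proof (rule suminf_emeasure)
      show "range V \<subseteq> sets lborel" by (auto simp: V_def)
      have "V i \<inter> V j = {}" if "i \<noteq> j" for i j
        using that c_in[of i] c_in[of j] c_inj[of i j] D(3) unfolding V_def pairwise_def
        by (cases "i \<in> I \<and> j \<in> I") auto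
      then show "disjoint_family V" by (auto simp: disjoint_family_on_def)
    qed
    also have "\<dots> \<le> emeasure lborel O'" using Ui(4) O'(1) by (intro emeasure_mono) auto
    also have "\<dots> = emeasure lborel (B \<union> (O' - B))"
      using O'(2) by (intro arg_cong[where f = "emeasure lborel"]) auto
    also have "\<dots> \<le> emeasure lborel B + emeasure lborel (O' - B)"
      using B(2) O'(1) by (intro emeasure_subadditive) auto
    also have "\<dots> \<le> emeasure lborel B + ennreal \<epsilon>" using O'(3) by (intro add_left_mono) simp
    finally show ?thesis by (simp add: mult_left_mono)
  qed
  have "hausdorff_premeasure 1 \<delta> (f ` B) \<le> emeasure lborel B" if "\<delta> > 0" for \<delta>
  proof -
    have "((\<lambda>\<epsilon>. ennreal (1 + \<epsilon>) * (emeasure lborel B + ennreal \<epsilon>)) \<longlongrightarrow>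
       ennreal (1 + 0) * (emeasure lborel B + ennreal 0)) (at_right 0)"
    proof (rule tendsto_mult_ennreal)
      show "((\<lambda>\<epsilon>. ennreal (1 + \<epsilon>)) \<longlongrightarrow> ennreal (1 + 0)) (at_right 0)"
        by (intro tendsto_ennrealI tendsto_intros)
      show "((\<lambda>\<epsilon>. emeasure lborel B + ennreal \<epsilon>) \<longlongrightarrow> emeasure lborel B + ennreal 0) (at_right 0)"
        by (intro tendsto_ennrealI tendsto_intros)
    qed simp_all
    moreover have "\<forall>\<^sub>F \<epsilon> in at_right 0. hausdorff_premeasure 1 \<delta> (f ` B) \<le> ennreal (1 + \<epsilon>) * (emeasure lborel B + ennreal \<epsilon>)"
      unfolding eventually_at_right_field using main[OF that] by (intro exI[of _ 1]) auto
    ultimately have "hausdorff_premeasure 1 \<delta> (f ` B) \<le> ennreal (1 + 0) * (emeasure lborel B + ennreal 0)"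
      by (rule tendsto_lowerbound) (rule trivial_limit_at_right_real)
    then show ?thesis by simp
  qed
  then show ?thesis unfolding hausdorff_outer_measure_def by (intro SUP_least) auto
qed

text \<open>A closed curve is injective only on the half-open parameter interval, while the lower
  estimate needs injectivity on a compact one. Cutting \<open>B\<close> off at
  \<open>b - 1 / Suc n\<close> and continuity of measure from below bridge the gap.\<close>

lemma hausdorff_eq_lborel:
  fixes f :: "real \<Rightarrow> 'a::metric_space"
  assumes iso: "near_isometry_on {a..b} f" and ab: "a < b" and inj: "inj_on f {a..<b}"
    and B: "B \<subseteq> {a..<b}" "B \<in> sets borel"
  shows "hausdorff_outer_measure 1 (f ` B) = emeasure lborel B"
proof (rule antisym)
  have "B \<subseteq> {a..b}" using B(1) by auto
  then show "hausdorff_outer_measure 1 (f ` B) \<le> emeasure lborel B"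
    using hausdorff_le_lborel[OF iso ab _ B(2)] by simp
  define C where "C n = B \<inter> {a..b - 1 / Suc n}" for n :: nat
  have "(SUP n. emeasure lborel (C n)) = emeasure lborel (\<Union>n. C n)"
  proof (rule SUP_emeasure_incseq)
    show "range C \<subseteq> sets lborel" using B(2) by (auto simp: C_def)
    show "incseq C"
    proof (rule incseq_SucI)
      fix n
      have "1 / real (Suc (Suc n)) \<le> 1 / real (Suc n)" by (intro divide_left_mono) auto
      then show "C n \<subseteq> C (Suc n)" unfolding C_def by auto
    qed
  qed
  also have "(\<Union>n. C n) = B"
  proof (intro equalityI subsetI)
    fix s assume s: "s \<in> B"
    then have "0 < b - s" using B(1) by auto
    then obtain n where "1 / Suc n < b - s"
      by (metis inverse_eq_divide reals_Archimedean)
    then have "s \<in> C n" using s B(1) by (auto simp: C_def)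
    then show "s \<in> (\<Union>n. C n)" by blast
  qed (auto simp: C_def)
  finally have eq: "emeasure lborel B = (SUP n. emeasure lborel (C n))" by simp
  show "emeasure lborel B \<le> hausdorff_outer_measure 1 (f ` B)"
    unfolding eq
  proof (rule SUP_least)
    fix n
    have "emeasure lborel (C n) \<le> hausdorff_outer_measure 1 (f ` C n)"
    proof (rule hausdorff_ge_lborel)
      show "near_isometry_on {a..b - 1 / Suc n} f" by (rule near_isometry_on_subset[OF iso]) auto
      show "inj_on f {a..b - 1 / Suc n}"
      proof (rule inj_on_subset[OF inj])
        have "0 < 1 / real (Suc n)" by simp
        then show "{a..b - 1 / Suc n} \<subseteq> {a..<b}" by (simp only: atLeastAtMost_subseteq_atLeastLessThan_iff) simp
      qed
      show "C n \<subseteq> {a..b - 1 / Suc n}" "C n \<in> sets borel" using B(2) by (auto simp: C_def)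
    qed
    also have "\<dots> \<le> hausdorff_outer_measure 1 (f ` B)"
      by (rule hausdorff_outer_measure_mono) (auto simp: C_def)
    finally show "emeasure lborel (C n) \<le> hausdorff_outer_measure 1 (f ` B)" .
  qed
qed

subsection \<open>Wirtinger's inequality and Stieltjes integration by parts\<close>

text \<open>With \<open>m\<close> the midpoint and \<open>T x = tan (k * (x - m))\<close>, the
  derivative of \<open>f\<^sup>2 k T\<close> exceeds \<open>k\<^sup>2 f\<^sup>2 - f'\<^sup>2\<close>
  by the square of \<open>f' + f k T\<close>, and its integral vanishes because \<open>f\<close>
  does at both ends. Taking \<open>k < 1\<close> keeps the tangent finite even on an interval of
  length pi; then \<open>k\<close> tends to 1.\<close>

lemma wirtinger_dirichlet:
  fixes f f' :: "real \<Rightarrow> real"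
  assumes "a \<le> b" "b - a \<le> pi" and f: "\<And>x. (f has_real_derivative f' x) (at x)"
    and f': "continuous_on UNIV f'" and ends: "f a = 0" "f b = 0"
  shows "integral {a..b} (\<lambda>x. (f x)\<^sup>2) \<le> integral {a..b} (\<lambda>x. (f' x)\<^sup>2)"
proof -
  have cf: "continuous_on UNIV f" using f by (meson DERIV_continuous_on has_field_derivative_at_within)
  have int: "(\<lambda>x. (f x)\<^sup>2) integrable_on {a..b}" "(\<lambda>x. (f' x)\<^sup>2) integrable_on {a..b}"
    by (intro integrable_continuous_real continuous_intros continuous_on_subset[OF cf] continuous_on_subset[OF f'] subset_UNIV)+
  have "k\<^sup>2 * integral {a..b} (\<lambda>x. (f x)\<^sup>2) \<le> integral {a..b} (\<lambda>x. (f' x)\<^sup>2)" if k: "0 < k" "k < 1" for k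
  proof -
    define m where "m = (a + b) / 2"
    define T where "T x = tan (k * (x - m))" for x
    have cos: "cos (k * (x - m)) > 0" if "x \<in> {a..b}" for x
    proof (rule cos_gt_zero_pi)
      have "\<bar>x - m\<bar> \<le> pi / 2" using that assms(2) by (auto simp: m_def abs_le_iff field_simps)
      then have "k * \<bar>x - m\<bar> \<le> k * (pi / 2)" using k by (intro mult_left_mono) auto
      also have "\<dots> < pi / 2" using k by simp
      finally have "\<bar>k * (x - m)\<bar> < pi / 2" using k by (simp add: abs_mult)
      then show "- (pi / 2) < k * (x - m)" "k * (x - m) < pi / 2" by linarith+
    qed
    define G where "G x = 2 * f x * f' x * (k * T x) + (f x)\<^sup>2 * (k\<^sup>2 * (1 + (T x)\<^sup>2))" for x
    have "((\<lambda>x. (f x)\<^sup>2 * (k * T x)) has_vector_derivative G x) (at x within {a..b})" if x: "x \<in> {a..b}" for x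
    proof -
      have T: "(T has_real_derivative k * (1 + (T x)\<^sup>2)) (at x)"
      proof -
        have "(T has_real_derivative inverse ((cos (k * (x - m)))\<^sup>2) * k) (at x)"
          unfolding T_def using cos[OF x] by (auto intro!: derivative_eq_intros)
        also have "inverse ((cos (k * (x - m)))\<^sup>2) = 1 + (T x)\<^sup>2"
          using cos[OF x] tan_sec[of "k * (x - m)"] by (simp add: T_def power_inverse)
        finally show ?thesis by (simp add: mult.commute)
      qed
      show ?thesis
        unfolding has_real_derivative_iff_has_vector_derivative[symmetric] G_def
        by (rule has_field_derivative_at_within)
          (auto intro!: derivative_eq_intros f T simp: algebra_simps power2_eq_square)
    qed
    then have G: "(G has_integral ((f b)\<^sup>2 * (k * T b) - (f a)\<^sup>2 * (k * T a))) {a..b}"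
      using \<open>a \<le> b\<close> by (intro fundamental_theorem_of_calculus) auto
    have "((\<lambda>x. k\<^sup>2 * (f x)\<^sup>2 - (f' x)\<^sup>2) has_integral
       (k\<^sup>2 * integral {a..b} (\<lambda>x. (f x)\<^sup>2) - integral {a..b} (\<lambda>x. (f' x)\<^sup>2))) {a..b}"
      by (intro has_integral_diff has_integral_mult_right integrable_integral int)
    note I = this
    have "k\<^sup>2 * integral {a..b} (\<lambda>x. (f x)\<^sup>2) - integral {a..b} (\<lambda>x. (f' x)\<^sup>2) \<le>
       (f b)\<^sup>2 * (k * T b) - (f a)\<^sup>2 * (k * T a)"
    proof -
      have "k\<^sup>2 * (f x)\<^sup>2 - (f' x)\<^sup>2 \<le> G x" for x
      proof -
        have "G x - (k\<^sup>2 * (f x)\<^sup>2 - (f' x)\<^sup>2) = (f' x + f x * (k * T x))\<^sup>2"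
          by (simp add: G_def algebra_simps power2_eq_square)
        then show ?thesis by (smt (verit) zero_le_power2)
      qed
      then show ?thesis using has_integral_le[OF I G] by blast
    qed
    then show ?thesis by (simp add: ends)
  qed
  note * = this
  have "((\<lambda>k::real. k\<^sup>2 * integral {a..b} (\<lambda>x. (f x)\<^sup>2)) \<longlongrightarrow> 1\<^sup>2 * integral {a..b} (\<lambda>x. (f x)\<^sup>2)) (at_left 1)"
    by (intro tendsto_intros)
  moreover have "\<forall>\<^sub>F k in at_left 1. k\<^sup>2 * integral {a..b} (\<lambda>x. (f x)\<^sup>2) \<le> integral {a..b} (\<lambda>x. (f' x)\<^sup>2)"
    unfolding eventually_at_left_field using * by (intro exI[of _ 0]) auto
  ultimately have "1\<^sup>2 * integral {a..b} (\<lambda>x. (f x)\<^sup>2) \<le> integral {a..b} (\<lambda>x. (f' x)\<^sup>2)"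
    by (rule tendsto_upperbound) (rule trivial_limit_at_left_real)
  then show ?thesis by simp
qed

text \<open>Three zeros that cut the circle into arcs of length at most \<open>\<pi>\<close> suffice.\<close>

lemma wirtinger_periodic:
  fixes f f' :: "real \<Rightarrow> real"
  assumes f: "\<And>x. (f has_real_derivative f' x) (at x)"
    and f': "continuous_on UNIV f'" and per: "\<And>x. f (x + 2 * pi) = f x"
    and per': "\<And>x. f' (x + 2 * pi) = f' x"
    and zeros: "\<And>\<alpha>. \<exists>x\<in>{\<alpha>..\<alpha> + pi}. f x = 0"
  shows "integral {0..2 * pi} (\<lambda>x. (f x)\<^sup>2 - (f' x)\<^sup>2) \<le> 0"
proof -
  have cf: "continuous_on UNIV f" using f by (meson DERIV_continuous_on has_field_derivative_at_within)
  define g where "g x = (f x)\<^sup>2 - (f' x)\<^sup>2" for x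
  have cg: "continuous_on S g" for S
    unfolding g_def
    by (intro continuous_intros continuous_on_subset[OF cf] continuous_on_subset[OF f'] subset_UNIV)
  have gi: "g integrable_on {a..b}" for a b by (rule integrable_continuous_real[OF cg])
  have le: "integral {a..b} g \<le> 0" if "a \<le> b" "b - a \<le> pi" "f a = 0" "f b = 0" for a b
  proof -
    have "integral {a..b} g = integral {a..b} (\<lambda>x. (f x)\<^sup>2) - integral {a..b} (\<lambda>x. (f' x)\<^sup>2)"
      unfolding g_def by (intro integral_diff integrable_continuous_real continuous_intros
          continuous_on_subset[OF cf] continuous_on_subset[OF f'] subset_UNIV)
    then show ?thesis using wirtinger_dirichlet[OF that(1,2) f f' that(3,4)] by simp
  qed
  have closed: "closed {x. f x = 0}"
    using continuous_closed_vimage[of "{0}" f] cf by (simp add: vimage_def continuous_on_eq_continuous_at)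
  obtain p where p: "0 \<le> p" "p \<le> pi" "f p = 0" using zeros[of 0] by auto
  \<comment> \<open>\<open>q\<close> will be the last zero in the half circle after \<open>p\<close>
    and \<open>r\<close> the first zero in the next one, so no zero lies strictly between
    them.\<close>
  define A where "A = {p..p + pi} \<inter> {x. f x = 0}"
  define B where "B = {p + pi..p + 2 * pi} \<inter> {x. f x = 0}"
  have "p \<in> A" "p + 2 * pi \<in> B" using p per by (auto simp: A_def B_def)
  moreover have "compact A" "compact B"
    unfolding A_def B_def using closed by (auto intro!: compact_Int_closed)
  ultimately obtain q r where q: "q \<in> A" "\<And>x. x \<in> A \<Longrightarrow> x \<le> q" and r: "r \<in> B" "\<And>x. x \<in> B \<Longrightarrow> r \<le> x"
    using compact_attains_sup[of A] compact_attains_inf[of B] by blast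
  have "r - q \<le> pi"
  proof (rule ccontr)
    assume far: "\<not> r - q \<le> pi"
    \<comment> \<open>This half circle is centred halfway between \<open>q\<close> and
      \<open>r\<close>. If they were more than pi apart, the zero in it would lie strictly between
      them.\<close>
    define \<alpha> where "\<alpha> = (q + r - pi) / 2"
    obtain x where x: "\<alpha> \<le> x" "x \<le> \<alpha> + pi" "f x = 0" using zeros[of \<alpha>] by auto
    have "q < x" "x < r" using x far by (auto simp: \<alpha>_def field_simps)
    then show False using q(1) r(1) q(2)[of x] r(2)[of x] x(3) by (cases "x \<le> p + pi") (auto simp: A_def B_def)
  qed
  then have "integral {p..q} g \<le> 0" "integral {q..r} g \<le> 0" "integral {r..p + 2 * pi} g \<le> 0"
    using q(1) r(1) p per by (auto intro!: le simp: A_def B_def)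
  moreover have "integral {p..q} g + integral {q..r} g = integral {p..r} g"
    using q(1) r(1) by (intro Henstock_Kurzweil_Integration.integral_combine gi) (auto simp: A_def B_def)
  moreover have "integral {p..r} g + integral {r..p + 2 * pi} g = integral {p..p + 2 * pi} g"
    using q(1) r(1) by (intro Henstock_Kurzweil_Integration.integral_combine gi) (auto simp: A_def B_def)
  \<comment> \<open>Periodicity lets the period starting at \<open>p\<close> replace the one
    starting at 0.\<close>
  moreover have "integral {p..2 * pi} g + integral {2 * pi..p + 2 * pi} g = integral {p..p + 2 * pi} g"
    using p pi_gt_zero by (intro Henstock_Kurzweil_Integration.integral_combine gi) (linarith+)
  moreover have "integral {0..p} g + integral {p..2 * pi} g = integral {0..2 * pi} g"
    using p pi_gt_zero by (intro Henstock_Kurzweil_Integration.integral_combine gi) (linarith+)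
  moreover have "integral {2 * pi..p + 2 * pi} g = integral {0..p} g"
  proof -
    have "integral {0..p} (\<lambda>x. g (x + 2 * pi)) = integral {0 + 2 * pi..p + 2 * pi} g"
      using integral_shift[where a = 0 and b = p and c = "2 * pi" and f = g] cg p by (simp add: o_def)
    moreover have "g (x + 2 * pi) = g x" for x by (simp add: g_def per per')
    ultimately show ?thesis by simp
  qed
  ultimately show ?thesis unfolding g_def by linarith
qed

text \<open>Formally \<open>E\<close> is the inverse of \<open>D\<close> and this is an integration by parts in the
  Stieltjes integral \<open>\<integral> g dD\<close>; \<open>D\<close> need not be absolutely continuous.\<close>

lemma integral_compose_inverse:
  fixes D E g g' :: "real \<Rightarrow> real"
  assumes "a \<le> b" and D: "continuous_on {a..b} D" "mono_on {a..b} D"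
    and E: "\<And>x. x \<in> {a..b} \<Longrightarrow> E (D x) = x" "continuous_on {D a..D b} E"
    and g: "\<And>x. (g has_real_derivative g' x) (at x)" "continuous_on UNIV g'"
  shows "integral {D a..D b} (\<lambda>s. g (E s)) = g b * D b - g a * D a - integral {a..b} (\<lambda>x. g' x * D x)"
proof -
  have cg: "continuous_on S g" for S
    using g(1) by (meson DERIV_continuous_on has_field_derivative_at_within)
  have mono: "D x \<le> D y" if "a \<le> x" "x \<le> y" "y \<le> b" for x y
    using D(2) that by (auto simp: mono_on_def)
  have surj: "\<exists>x\<in>{u..v}. D x = s" if "a \<le> u" "u \<le> v" "v \<le> b" "s \<in> {D u..D v}" for u v s
    using IVT'[of D u s v] that continuous_on_subset[OF D(1), of "{u..v}"] by auto
  have Ein: "E s \<in> {u..v}" if "a \<le> u" "u \<le> v" "v \<le> b" "s \<in> {D u..D v}" for u v s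
    using surj[OF that] E(1) that by auto
  have cgE: "continuous_on {D u..D v} (\<lambda>s. g (E s))" if "a \<le> u" "v \<le> b" "u \<le> v" for u v
    using mono[of a u] mono[of v b] that
    by (intro continuous_on_compose2[OF cg[of UNIV]] continuous_on_subset[OF E(2)]) auto
  have cgD: "continuous_on {u..v} (\<lambda>x. g' x * D x)" if "a \<le> u" "v \<le> b" for u v
    using that by (intro continuous_intros continuous_on_subset[OF D(1)] continuous_on_subset[OF g(2)]) auto
  obtain M where M: "M > 0" "\<And>x. x \<in> {a..b} \<Longrightarrow> \<bar>g' x\<bar> \<le> M"
    using compact_imp_bounded[OF compact_continuous_image[OF continuous_on_subset[OF g(2)], of "{a..b}"]]
    unfolding bounded_pos by auto
  \<comment> \<open>The difference of the two sides as a function of the upper endpoint; it remains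
    to see that it is constant.\<close>
  define P where "P x = integral {D a..D x} (\<lambda>s. g (E s)) - (g x * D x - g a * D a) + integral {a..x} (\<lambda>x. g' x * D x)" for x
  \<comment> \<open>Subtracting the value of \<open>g\<close> at \<open>v\<close> and that of
    \<open>D\<close> at \<open>u\<close> leaves two integrals of size at most
    \<open>M * (v - u) * (D v - D u)\<close>. By continuity of \<open>D\<close> this is of smaller
    order than \<open>v - u\<close>, even where \<open>D\<close> has no derivative.\<close>
  have step: "\<bar>P v - P u\<bar> \<le> 2 * M * (v - u) * (D v - D u)" if uv: "a \<le> u" "u \<le> v" "v \<le> b" for u v
  proof -
    have i1: "integral {D a..D u} (\<lambda>s. g (E s)) + integral {D u..D v} (\<lambda>s. g (E s)) = integral {D a..D v} (\<lambda>s. g (E s))"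
      using uv mono[of a u] mono[of u v] by (intro Henstock_Kurzweil_Integration.integral_combine integrable_continuous_real cgE) auto
    have i2: "integral {a..u} (\<lambda>x. g' x * D x) + integral {u..v} (\<lambda>x. g' x * D x) = integral {a..v} (\<lambda>x. g' x * D x)"
      using uv by (intro Henstock_Kurzweil_Integration.integral_combine integrable_continuous_real cgD) auto
    have lip: "\<bar>g x - g v\<bar> \<le> M * (v - u)" if "x \<in> {u..v}" for x
    proof -
      have "norm (g x - g v) \<le> M * norm (x - v)"
        using that uv M(2) by (intro field_differentiable_bound[of "{u..v}" g g'])
          (auto intro: has_field_derivative_at_within g(1))
      also have "\<dots> \<le> M * (v - u)" using that M(1) by (intro mult_left_mono) auto
      finally show ?thesis by simp
    qed
    have "integral {D u..D v} (\<lambda>s. g (E s) - g v) = integral {D u..D v} (\<lambda>s. g (E s)) - g v * (D v - D u)"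
      using uv mono[of u v] by (subst integral_diff) (auto intro!: integrable_continuous_real cgE)
    moreover have "\<bar>integral {D u..D v} (\<lambda>s. g (E s) - g v)\<bar> \<le> M * (v - u) * (D v - D u)"
    proof -
      have "norm (integral (cbox (D u) (D v)) (\<lambda>s. g (E s) - g v)) \<le> M * (v - u) * measure lborel (cbox (D u) (D v))"
        using uv M(1) lip[OF Ein[OF uv]] cgE[of u v]
        by (intro integrable_bound integrable_continuous continuous_intros) (auto simp: box_real)
      then show ?thesis using mono[OF uv] by simp
    qed
    moreover have "integral {u..v} (\<lambda>x. g' x * (D x - D u)) = integral {u..v} (\<lambda>x. g' x * D x) - D u * (g v - g u)"
    proof -
      have "(g' has_integral (g v - g u)) {u..v}"
        using uv(2) by (intro fundamental_theorem_of_calculus)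
          (auto simp flip: has_real_derivative_iff_has_vector_derivative intro: has_field_derivative_at_within g(1))
      then have "((\<lambda>x. g' x * D x - D u * g' x) has_integral integral {u..v} (\<lambda>x. g' x * D x) - D u * (g v - g u)) {u..v}"
        using uv by (intro has_integral_diff has_integral_mult_right integrable_integral integrable_continuous_real cgD) auto
      then show ?thesis by (intro integral_unique) (simp add: algebra_simps)
    qed
    moreover have "\<bar>integral {u..v} (\<lambda>x. g' x * (D x - D u))\<bar> \<le> M * (D v - D u) * (v - u)"
    proof -
      have "\<bar>g' x * (D x - D u)\<bar> \<le> M * (D v - D u)" if "x \<in> {u..v}" for x
        unfolding abs_mult using that uv M mono[of u x] mono[of x v] by (intro mult_mono) auto
      moreover have "continuous_on {u..v} (\<lambda>x. g' x * (D x - D u))"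
        using uv by (intro continuous_intros continuous_on_subset[OF D(1)] continuous_on_subset[OF g(2)]) auto
      ultimately have "norm (integral (cbox u v) (\<lambda>x. g' x * (D x - D u))) \<le> M * (D v - D u) * measure lborel (cbox u v)"
        using M(1) mono[OF uv] by (intro integrable_bound integrable_continuous) (auto simp: box_real)
      then show ?thesis using uv by simp
    qed
    moreover have "P v - P u = integral {D u..D v} (\<lambda>s. g (E s) - g v) + integral {u..v} (\<lambda>x. g' x * (D x - D u))"
      unfolding P_def using i1 i2 calculation(1,3) by (simp add: algebra_simps)
    ultimately show ?thesis by (simp add: algebra_simps)
  qed
  have "P b = P a"
  proof (cases "a < b")
    case True
    have "(P has_real_derivative 0) (at x within {a..b})" if x: "x \<in> {a..b}" for x
    proof -
      have quot: "\<bar>(P y - P x) / (y - x)\<bar> \<le> 2 * M * \<bar>D y - D x\<bar>" if "y \<in> {a..b}" "y \<noteq> x" for y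
      proof -
        have "\<bar>P y - P x\<bar> \<le> 2 * M * \<bar>y - x\<bar> * \<bar>D y - D x\<bar>"
          using step[of x y] step[of y x] mono[of x y] mono[of y x] that x
          by (cases "x \<le> y") (auto simp: abs_minus_commute)
        then show ?thesis using that by (simp add: abs_divide divide_le_eq mult.assoc mult.commute[of _ "\<bar>y - x\<bar>"] mult.left_commute[of _ "\<bar>y - x\<bar>"])
      qed
      have "((\<lambda>y. 2 * M * \<bar>D y - D x\<bar>) \<longlongrightarrow> 2 * M * \<bar>D x - D x\<bar>) (at x within {a..b})"
        using D(1) x by (intro tendsto_intros) (auto simp: continuous_on_def)
      then have "((\<lambda>y. 2 * M * \<bar>D y - D x\<bar>) \<longlongrightarrow> 0) (at x within {a..b})" by simp
      moreover have "\<forall>\<^sub>F y in at x within {a..b}. norm ((P y - P x) / (y - x)) \<le> 2 * M * \<bar>D y - D x\<bar>"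
        unfolding eventually_at_filter real_norm_def by (intro always_eventually allI impI quot)
      ultimately have "((\<lambda>y. (P y - P x) / (y - x)) \<longlongrightarrow> 0) (at x within {a..b})"
        by (rule Lim_null_comparison[rotated])
      then show ?thesis by (simp add: has_field_derivative_iff)
    qed
    then show ?thesis
      using has_field_derivative_zero_constant[of "{a..b}" P] True by fastforce
  qed (use \<open>a \<le> b\<close> in auto)
  then show ?thesis by (simp add: P_def)
qed

subsection \<open>Support functions and relative radii\<close>

lemma support_fun_attained:
  assumes "compact K" "K \<noteq> {}"
  obtains y where "y \<in> K" "x \<bullet> y = support_fun K x"
proof -
  obtain y where y: "y \<in> K" "\<And>z. z \<in> K \<Longrightarrow> x \<bullet> z \<le> x \<bullet> y"
    using continuous_attains_sup[OF assms, of "\<lambda>y. x \<bullet> y"] continuous_on_inner[OF continuous_on_const continuous_on_id]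
    by blast
  have "support_fun K x = x \<bullet> y"
    unfolding support_fun_def using y by (intro cSup_eq_maximum) auto
  with y that show thesis by simp
qed

lemma support_fun_upper:
  assumes "compact K" "y \<in> K"
  shows "x \<bullet> y \<le> support_fun K x"
proof -
  have "bounded ((\<bullet>) x ` K)"
    using assms by (intro compact_imp_bounded compact_continuous_image continuous_intros)
  then show ?thesis
    unfolding support_fun_def using assms by (intro cSUP_upper bounded_imp_bdd_above)
qed

text \<open>A point outside is strictly separated from the body, and the normalised separating
  normal violates its support inequality.\<close>

lemma mem_convex_iff_support_fun:
  assumes "compact K" "convex K" "K \<noteq> {}"
  shows "y \<in> K \<longleftrightarrow> (\<forall>u\<in>sphere 0 1. u \<bullet> y \<le> support_fun K u)"
proof
  assume *: "\<forall>u\<in>sphere 0 1. u \<bullet> y \<le> support_fun K u"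
  show "y \<in> K"
  proof (rule ccontr)
    assume "y \<notin> K"
    then obtain a b where ab: "a \<bullet> y < b" "\<And>x. x \<in> K \<Longrightarrow> b < a \<bullet> x"
      using separating_hyperplane_closed_point[OF assms(2) compact_imp_closed[OF assms(1)]] by blast
    then have "a \<noteq> 0" using assms(3) by force
    define u where "u = (- 1 / norm a) *\<^sub>R a"
    have "u \<in> sphere 0 1" using \<open>a \<noteq> 0\<close> by (simp add: u_def)
    moreover obtain z where "z \<in> K" "u \<bullet> z = support_fun K u" using support_fun_attained[OF assms(1,3)] .
    ultimately have "u \<bullet> y \<le> u \<bullet> z" using * by metis
    moreover have "a \<bullet> y < a \<bullet> z" using ab \<open>z \<in> K\<close> by force
    ultimately show False using \<open>a \<noteq> 0\<close> by (simp add: u_def divide_right_mono field_simps)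
  qed
qed (use support_fun_upper assms in blast)

lemma support_fun_lipschitz:
  assumes "compact K" "K \<noteq> {}" "\<And>y. y \<in> K \<Longrightarrow> norm y \<le> M"
  shows "\<bar>support_fun K x - support_fun K z\<bar> \<le> M * norm (x - z)"
proof -
  have "support_fun K x - support_fun K z \<le> M * norm (x - z)" for x z
  proof -
    obtain y where y: "y \<in> K" "x \<bullet> y = support_fun K x" using support_fun_attained[OF assms(1,2)] .
    have "support_fun K x - support_fun K z \<le> (x - z) \<bullet> y"
      using y support_fun_upper[OF assms(1) y(1), of z] by (simp add: inner_diff_left)
    also have "\<dots> \<le> norm (x - z) * norm y" by (rule norm_cauchy_schwarz)
    also have "\<dots> \<le> norm (x - z) * M" using assms(3)[OF y(1)] by (rule mult_left_mono) simp
    finally show ?thesis by (simp add: mult.commute)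
  qed
  from this[of x z] this[of z x] show ?thesis by (simp add: norm_minus_commute abs_le_iff)
qed

lemma continuous_on_support_fun:
  assumes "compact K" "K \<noteq> {}"
  shows "continuous_on S (support_fun K)"
proof -
  obtain M where M: "M > 0" "\<And>y. y \<in> K \<Longrightarrow> norm y \<le> M"
    using compact_imp_bounded[OF assms(1)] unfolding bounded_pos by auto
  then have "M-lipschitz_on S (support_fun K)"
    using support_fun_lipschitz[OF assms M(2)] by (intro lipschitz_onI) (auto simp: dist_norm)
  then show ?thesis by (rule lipschitz_on_continuous_on)
qed

lemma support_fun_pos:
  assumes "compact K" "0 \<in> interior K" "u \<in> sphere 0 1"
  shows "support_fun K u > 0"
proof -
  obtain e where e: "e > 0" "cball 0 e \<subseteq> K" using assms(2) mem_interior_cball by blast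
  have "e *\<^sub>R u \<in> K" using e assms(3) by (intro subsetD[OF e(2)]) simp
  from support_fun_upper[OF assms(1) this, of u] e(1) assms(3) show ?thesis
    by (simp add: dot_square_norm)
qed

lemma outer_unit_normal_iff_support_fun:
  assumes "compact K" "y \<in> K"
  shows "outer_unit_normal K y u \<longleftrightarrow> norm u = 1 \<and> u \<bullet> y = support_fun K u"
proof -
  obtain z where z: "z \<in> K" "u \<bullet> z = support_fun K u" using support_fun_attained[OF assms(1)] assms(2) by blast
  then have "u \<bullet> y = support_fun K u" if "\<forall>x\<in>K. u \<bullet> x \<le> u \<bullet> y"
    using that support_fun_upper[OF assms, of u] by force
  then show ?thesis using support_fun_upper[OF assms(1)] unfolding outer_unit_normal_def by metis
qed

text \<open>The midpoint of two contact points would be interior, and a small step from it along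
  \<open>u\<close> would exceed the support value.\<close>

lemma strictly_convex_support_point_unique:
  assumes K: "compact K" "strictly_convex K" and "u \<noteq> 0"
    and "y \<in> K" "z \<in> K" "u \<bullet> y = support_fun K u" "u \<bullet> z = support_fun K u"
  shows "y = z"
proof (rule ccontr)
  assume "y \<noteq> z"
  have "midpoint y z \<in> interior K"
    using K(2) \<open>y \<noteq> z\<close> assms(4,5) unfolding strictly_convex_def
    by (metis midpoint_in_open_segment subsetD)
  then obtain e where e: "e > 0" "cball (midpoint y z) e \<subseteq> K" using mem_interior_cball by blast
  have "midpoint y z + (e / norm u) *\<^sub>R u \<in> K"
    using e \<open>u \<noteq> 0\<close> by (intro subsetD[OF e(2)]) (simp add: dist_norm)
  from support_fun_upper[OF K(1) this, of u]
  have "u \<bullet> midpoint y z + (e / norm u) * (u \<bullet> u) \<le> support_fun K u" by (simp add: inner_add_right)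
  moreover have "u \<bullet> midpoint y z = support_fun K u"
    using assms(6,7) by (simp add: midpoint_def inner_add_right)
  moreover have "(e / norm u) * (u \<bullet> u) > 0" using e(1) \<open>u \<noteq> 0\<close> by simp
  ultimately show False by simp
qed

lemma support_point_in_frontier:
  assumes "compact K" "y \<in> K" "u \<noteq> 0" "u \<bullet> y = support_fun K u"
  shows "y \<in> frontier K"
proof -
  have "y \<notin> interior K"
  proof
    assume "y \<in> interior K"
    then obtain e where e: "e > 0" "cball y e \<subseteq> K" using mem_interior_cball by blast
    have "y + (e / norm u) *\<^sub>R u \<in> K"
      using e \<open>u \<noteq> 0\<close> by (intro subsetD[OF e(2)]) (simp add: dist_norm)
    from support_fun_upper[OF assms(1) this, of u]
    have "u \<bullet> y + (e / norm u) * (u \<bullet> u) \<le> support_fun K u" by (simp add: inner_add_right)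
    moreover have "(e / norm u) * (u \<bullet> u) > 0" using e(1) \<open>u \<noteq> 0\<close> by simp
    ultimately show False using assms(4) by simp
  qed
  then show ?thesis using assms(1,2) by (simp add: frontier_def compact_imp_closed)
qed

text \<open>Turns inequalities between support functions into inclusions. The contact lemmas use it
  to build homothets that contradict the extremality of the relative radii.\<close>

lemma support_fun_homothetic_subset:
  assumes K: "compact K" "convex K" "K \<noteq> {}" and L: "compact L" and "t \<ge> 0"
    and le: "\<And>u. u \<in> sphere 0 1 \<Longrightarrow> u \<bullet> x + t * support_fun L u \<le> support_fun K u"
  shows "(\<lambda>y. x + t *\<^sub>R y) ` L \<subseteq> K"
proof safe
  fix y assume "y \<in> L"
  show "x + t *\<^sub>R y \<in> K"
    unfolding mem_convex_iff_support_fun[OF K]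
  proof
    fix u :: 'a assume u: "u \<in> sphere 0 1"
    show "u \<bullet> (x + t *\<^sub>R y) \<le> support_fun K u"
      using le[OF u] mult_left_mono[OF support_fun_upper[OF L \<open>y \<in> L\<close>, of u] \<open>t \<ge> 0\<close>]
      by (simp add: inner_add_right)
  qed
qed

lemma positive_lower_bound_on_sphere:
  fixes F :: "'a::euclidean_space \<Rightarrow> real"
  assumes "continuous_on (sphere 0 1) F" "\<And>u. u \<in> sphere 0 1 \<Longrightarrow> F u > 0"
  obtains m where "m > 0" "\<And>u. u \<in> sphere 0 1 \<Longrightarrow> m \<le> F u"
proof -
  have "sphere (0::'a) 1 \<noteq> {}" by simp
  then obtain v where "v \<in> sphere 0 1" "\<And>u. u \<in> sphere 0 1 \<Longrightarrow> F v \<le> F u"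
    using continuous_attains_inf[OF compact_sphere _ assms(1)] by blast
  with assms(2) that show thesis by blast
qed

text \<open>Applied to differences of support functions, this moves a homothet off its points of
  contact.\<close>

lemma tilt_positive:
  fixes f :: "'a::euclidean_space \<Rightarrow> real"
  assumes f: "continuous_on (sphere 0 1) f" "\<And>u. u \<in> sphere 0 1 \<Longrightarrow> f u \<ge> 0"
    and v: "v \<in> sphere 0 1" and pos: "\<And>u. \<lbrakk>u \<in> sphere 0 1; v \<bullet> u \<ge> 0\<rbrakk> \<Longrightarrow> f u \<noteq> 0"
  obtains e m where "e > 0" "m > 0" "\<And>u. u \<in> sphere 0 1 \<Longrightarrow> e * (v \<bullet> u) + m \<le> f u"
proof -
  have "compact (sphere 0 1 \<inter> {u. v \<bullet> u \<ge> 0})"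
    by (intro compact_Int_closed closed_Collect_le continuous_intros) auto
  moreover have "v \<in> sphere 0 1 \<inter> {u. v \<bullet> u \<ge> 0}" using v by auto
  ultimately obtain w where w: "w \<in> sphere 0 1 \<inter> {u. v \<bullet> u \<ge> 0}"
    "\<And>u. u \<in> sphere 0 1 \<inter> {u. v \<bullet> u \<ge> 0} \<Longrightarrow> f w \<le> f u"
    using continuous_attains_inf[of "sphere 0 1 \<inter> {u. v \<bullet> u \<ge> 0}" f] continuous_on_subset[OF f(1)]
    by (metis emptyE inf_le1)
  define e where "e = f w / 2"
  have e: "e > 0" using w(1) f(2)[of w] pos[of w] by (auto simp: e_def less_le)
  have "f u - e * (v \<bullet> u) > 0" if u: "u \<in> sphere 0 1" for u
  proof (cases "v \<bullet> u \<ge> 0")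
    case True
    have "v \<bullet> u \<le> 1" using norm_cauchy_schwarz[of v u] u v by simp
    then have "e * (v \<bullet> u) \<le> e" using e by (simp add: mult_left_le)
    also have "e < f w" using e by (simp add: e_def)
    also have "f w \<le> f u" using w(2) u True by blast
    finally show ?thesis by simp
  next
    case False
    then have "e * (v \<bullet> u) < 0" using e by (simp add: mult_pos_neg)
    then show ?thesis using f(2)[OF u] by simp
  qed
  moreover have "continuous_on (sphere 0 1) (\<lambda>u. f u - e * (v \<bullet> u))" by (intro continuous_intros f(1))
  ultimately obtain m where "m > 0" "\<And>u. u \<in> sphere 0 1 \<Longrightarrow> m \<le> f u - e * (v \<bullet> u)"
    using positive_lower_bound_on_sphere[of "\<lambda>u. f u - e * (v \<bullet> u)"] by blast
  then show thesis using that[of e m] e by (auto simp: algebra_simps)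
qed

section \<open>Contact directions of two bodies in dilation position\<close>

context
  fixes K L :: "'a::euclidean_space set"
  assumes K: "compact K" "convex K" "0 \<in> interior K"
    and L: "compact L" "convex L" "0 \<in> interior L"
    and dil: "dilation_position K L"
begin

lemma dilation_position_nonempty: "K \<noteq> {}" "L \<noteq> {}"
  using K(3) L(3) interior_subset by blast+

lemma rel_inradius_support_le:
  shows "rel_inradius K L * support_fun L u \<le> support_fun K u"
proof -
  obtain y where y: "y \<in> L" "u \<bullet> y = support_fun L u"
    using support_fun_attained[OF L(1) dilation_position_nonempty(2)] .
  have "rel_inradius K L *\<^sub>R y \<in> K" using dil y(1) unfolding dilation_position_def by auto
  from support_fun_upper[OF K(1) this, of u] y(2) show ?thesis by simp
qed

text \<open>The infimum is meaningful only for a non-empty set. By compactness the quotient of the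
  support functions is at least some \<open>m > 0\<close>, so \<open>m K\<close> fits into
  \<open>L\<close> and \<open>1 / m\<close> is an admissible factor.\<close>

lemma rel_circumradius_nonneg: "rel_circumradius K L \<ge> 0"
proof -
  have pos: "support_fun L u / support_fun K u > 0" if "u \<in> sphere 0 1" for u
    using support_fun_pos[OF L(1,3) that] support_fun_pos[OF K(1,3) that] by simp
  have "support_fun K u \<noteq> 0" if "u \<in> sphere 0 1" for u
    using support_fun_pos[OF K(1,3) that] by simp
  then have "continuous_on (sphere 0 1) (\<lambda>u. support_fun L u / support_fun K u)"
    by (intro continuous_on_divide continuous_on_support_fun K L dilation_position_nonempty) blast
  then obtain m where m: "m > 0" "\<And>u. u \<in> sphere 0 1 \<Longrightarrow> m \<le> support_fun L u / support_fun K u"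
    using positive_lower_bound_on_sphere[of "\<lambda>u. support_fun L u / support_fun K u"] pos by blast
  have sub: "(\<lambda>y. 0 + m *\<^sub>R y) ` K \<subseteq> L"
  proof (rule support_fun_homothetic_subset)
    fix u :: 'a assume u: "u \<in> sphere 0 1"
    show "u \<bullet> 0 + m * support_fun K u \<le> support_fun L u"
      using m(2)[OF u] support_fun_pos[OF K(1,3) u] by (simp add: pos_le_divide_eq)
  qed (use K L dilation_position_nonempty m(1) in auto)
  have "K \<subseteq> (\<lambda>y. 0 + (1 / m) *\<^sub>R y) ` L"
  proof
    fix y assume "y \<in> K"
    then have "m *\<^sub>R y \<in> L" using sub by auto
    then show "y \<in> (\<lambda>y. 0 + (1 / m) *\<^sub>R y) ` L" using m(1) by (intro image_eqI[of _ _ "m *\<^sub>R y"]) auto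
  qed
  moreover have "1 / m > 0" using m(1) by simp
  ultimately have "{t. t > 0 \<and> (\<exists>x. K \<subseteq> (\<lambda>y. x + t *\<^sub>R y) ` L)} \<noteq> {}" by blast
  then show ?thesis unfolding rel_circumradius_def by (rule cInf_greatest) auto
qed

lemma rel_circumradius_support_ge:
  shows "support_fun K u \<le> rel_circumradius K L * support_fun L u"
proof -
  obtain y where y: "y \<in> K" "u \<bullet> y = support_fun K u"
    using support_fun_attained[OF K(1) dilation_position_nonempty(1)] .
  obtain z where z: "z \<in> L" "y = rel_circumradius K L *\<^sub>R z"
    using dil y(1) unfolding dilation_position_def by auto
  show ?thesis
    using y(2) mult_left_mono[OF support_fun_upper[OF L(1) z(1), of u] rel_circumradius_nonneg] z(2) by simp
qed

text \<open>If the closed half sphere around \<open>v\<close> had no contact direction, a shift by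
  \<open>e v\<close> would open a gap of at least \<open>m\<close> in every direction. The factor
  could then grow by \<open>m / M\<close>, where \<open>M\<close> bounds the norms in
  \<open>L\<close>, against the maximality of the inradius.\<close>

lemma rel_inradius_contact:
  assumes v: "v \<in> sphere 0 1"
  shows "\<exists>u\<in>sphere 0 1. v \<bullet> u \<ge> 0 \<and> support_fun K u - rel_inradius K L * support_fun L u = 0"
proof (rule ccontr)
  let ?r = "rel_inradius K L"
  assume "\<not> ?thesis"
  then have ne: "support_fun K u - ?r * support_fun L u \<noteq> 0" if "u \<in> sphere 0 1" "v \<bullet> u \<ge> 0" for u
    using that by blast
  have "continuous_on (sphere 0 1) (\<lambda>u. support_fun K u - ?r * support_fun L u)"
    by (intro continuous_intros continuous_on_support_fun K L dilation_position_nonempty)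
  then obtain e m where em: "e > 0" "m > 0"
    "\<And>u. u \<in> sphere 0 1 \<Longrightarrow> e * (v \<bullet> u) + m \<le> support_fun K u - ?r * support_fun L u"
    using tilt_positive[of "\<lambda>u. support_fun K u - ?r * support_fun L u" v] v ne rel_inradius_support_le
    by (auto simp: algebra_simps)
  obtain M where M: "M > 0" "\<And>y. y \<in> L \<Longrightarrow> norm y \<le> M"
    using compact_imp_bounded[OF L(1)] unfolding bounded_pos by auto
  have hM: "support_fun L u \<le> M" if "u \<in> sphere 0 1" for u
  proof -
    obtain y where "y \<in> L" "u \<bullet> y = support_fun L u"
      using support_fun_attained[OF L(1) dilation_position_nonempty(2)] .
    then show ?thesis using M(2) norm_cauchy_schwarz[of u y] that by force
  qed
  let ?S = "{t. t > 0 \<and> (\<exists>x. (\<lambda>y. x + t *\<^sub>R y) ` L \<subseteq> K)}"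
  \<comment> \<open>Only for a bounded set is \<open>Sup\<close> an upper bound. Adding the
    inequalities for \<open>v\<close> and \<open>- v\<close> compares widths and cancels the
    translation.\<close>
  have bdd: "bdd_above ?S"
  proof (rule bdd_aboveI)
    fix t assume "t \<in> ?S"
    then obtain x where t: "t > 0" and x: "(\<lambda>y. x + t *\<^sub>R y) ` L \<subseteq> K" by auto
    have le: "u \<bullet> x + t * support_fun L u \<le> support_fun K u" for u
    proof -
      obtain y where y: "y \<in> L" "u \<bullet> y = support_fun L u"
        using support_fun_attained[OF L(1) dilation_position_nonempty(2)] .
      have "x + t *\<^sub>R y \<in> K" using x y by auto
      from support_fun_upper[OF K(1) this, of u] y(2) show ?thesis by (simp add: inner_add_right)
    qed
    have "t * (support_fun L v + support_fun L (- v)) \<le> support_fun K v + support_fun K (- v)"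
      using le[of v] le[of "- v"] by (simp add: algebra_simps)
    moreover have "support_fun L v > 0" "support_fun L (- v) > 0"
      using support_fun_pos[OF L(1,3)] v by auto
    ultimately show "t \<le> (support_fun K v + support_fun K (- v)) / (support_fun L v + support_fun L (- v))"
      by (simp add: pos_le_divide_eq)
  qed
  have sub: "(\<lambda>y. e *\<^sub>R v + t *\<^sub>R y) ` L \<subseteq> K" if t: "0 \<le> t" "t \<le> ?r + m / M" for t
  proof (rule support_fun_homothetic_subset)
    fix u :: 'a assume u: "u \<in> sphere 0 1"
    have "(t - ?r) * support_fun L u \<le> m / M * support_fun L u"
      using t support_fun_pos[OF L(1,3) u] by (intro mult_right_mono) auto
    also have "\<dots> \<le> m / M * M" using hM[OF u] em(2) M(1) by (intro mult_left_mono) auto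
    finally show "u \<bullet> e *\<^sub>R v + t * support_fun L u \<le> support_fun K u"
      using em(3)[OF u] M(1) by (simp add: inner_commute algebra_simps)
  qed (use K L dilation_position_nonempty t in auto)
  show False
  proof (cases "?r + m / M > 0")
    case True
    then have "?r + m / M \<in> ?S" using sub[of "?r + m / M"] by auto
    from cSup_upper[OF this bdd] have "m / M \<le> 0" by (simp add: rel_inradius_def)
    then show False using divide_pos_pos[OF em(2) M(1)] by simp
  next
    case False
    obtain d where d: "d > 0" "cball 0 d \<subseteq> K" using K(3) mem_interior_cball by blast
    have "(\<lambda>y. 0 + (d / M) *\<^sub>R y) ` L \<subseteq> K"
    proof clarify
      fix y assume "y \<in> L"
      then have "norm ((d / M) *\<^sub>R y) \<le> d" using M d by (simp add: field_simps mult_left_mono)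
      then show "0 + (d / M) *\<^sub>R y \<in> K" using d(2) by (auto simp: mem_cball)
    qed
    then have "d / M \<in> ?S" using d M by (auto intro!: exI[of _ 0])
    from cSup_upper[OF this bdd] have "?r \<ge> d / M" by (simp add: rel_inradius_def)
    moreover have "d / M > 0" "m / M > 0" using d M em by simp_all
    ultimately show False using False by linarith
  qed
qed

text \<open>Dual to the inradius: without contact in the half sphere, the shift of \<open>K\<close>
  by \<open>e v\<close> leaves a gap of at least \<open>m\<close> inside the homothet of
  \<open>L\<close>, so the factor could shrink by \<open>m / M\<close>.\<close>

lemma rel_circumradius_contact:
  assumes v: "v \<in> sphere 0 1"
  shows "\<exists>u\<in>sphere 0 1. v \<bullet> u \<ge> 0 \<and> rel_circumradius K L * support_fun L u - support_fun K u = 0"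
proof (rule ccontr)
  let ?R = "rel_circumradius K L"
  assume "\<not> ?thesis"
  then have ne: "?R * support_fun L u - support_fun K u \<noteq> 0" if "u \<in> sphere 0 1" "v \<bullet> u \<ge> 0" for u
    using that by blast
  have "continuous_on (sphere 0 1) (\<lambda>u. ?R * support_fun L u - support_fun K u)"
    by (intro continuous_intros continuous_on_support_fun K L dilation_position_nonempty)
  then obtain e m where em: "e > 0" "m > 0"
    "\<And>u. u \<in> sphere 0 1 \<Longrightarrow> e * (v \<bullet> u) + m \<le> ?R * support_fun L u - support_fun K u"
    using tilt_positive[of "\<lambda>u. ?R * support_fun L u - support_fun K u" v] v ne rel_circumradius_support_ge
    by (auto simp: algebra_simps)
  obtain M where M: "M > 0" "\<And>y. y \<in> L \<Longrightarrow> norm y \<le> M"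
    using compact_imp_bounded[OF L(1)] unfolding bounded_pos by auto
  have hM: "support_fun L u \<le> M" if "u \<in> sphere 0 1" for u
  proof -
    obtain y where "y \<in> L" "u \<bullet> y = support_fun L u"
      using support_fun_attained[OF L(1) dilation_position_nonempty(2)] .
    then show ?thesis using M(2) norm_cauchy_schwarz[of u y] that by force
  qed
  define t where "t = ?R - m / M"
  have key: "support_fun K u + e * (v \<bullet> u) \<le> t * support_fun L u" if u: "u \<in> sphere 0 1" for u
  proof -
    have "m / M * support_fun L u \<le> m / M * M" using hM[OF u] em(2) M(1) by (intro mult_left_mono) auto
    then show ?thesis using em(3)[OF u] M(1) by (simp add: t_def algebra_simps)
  qed
  \<comment> \<open>In the direction \<open>v\<close> itself the left-hand side of
    \<open>key\<close> is positive, which forces the reduced factor \<open>t\<close> to be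
    positive.\<close>
  have "0 < support_fun K v + e * (v \<bullet> v)"
    using support_fun_pos[OF K(1,3) v] em(1) v by (simp add: add_pos_nonneg)
  then have "0 < t * support_fun L v" using key[OF v] by linarith
  then have t: "t > 0" using support_fun_pos[OF L(1,3) v] by (simp add: zero_less_mult_iff)
  \<comment> \<open>The inclusion of the shifted \<open>K\<close> in \<open>t L\<close> is proved
    after division by \<open>t\<close>, where it is an inclusion of a homothet of \<open>K\<close>
    in the body \<open>L\<close>.\<close>
  have "(\<lambda>y. (e / t) *\<^sub>R v + (1 / t) *\<^sub>R y) ` K \<subseteq> L"
  proof (rule support_fun_homothetic_subset)
    fix u :: 'a assume u: "u \<in> sphere 0 1"
    show "u \<bullet> (e / t) *\<^sub>R v + 1 / t * support_fun K u \<le> support_fun L u"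
      using key[OF u] t by (simp add: inner_commute field_simps)
  qed (use K L dilation_position_nonempty t in auto)
  then have "K \<subseteq> (\<lambda>y. - e *\<^sub>R v + t *\<^sub>R y) ` L"
  proof -
    have "y \<in> (\<lambda>y. - e *\<^sub>R v + t *\<^sub>R y) ` L" if "y \<in> K" for y
      using that t \<open>_ ` K \<subseteq> L\<close>
      by (intro image_eqI[of _ _ "(e / t) *\<^sub>R v + (1 / t) *\<^sub>R y"]) (auto simp: scaleR_add_right)
    then show ?thesis by blast
  qed
  then have "?R \<le> t"
    unfolding rel_circumradius_def using t by (intro cInf_lower bdd_belowI[of _ 0] CollectI conjI exI[of _ "- e *\<^sub>R v"]) auto
  then show False using divide_pos_pos[OF em(2) M(1)] by (simp add: t_def)
qed

end

subsection \<open>The boundary curve of a planar body\<close>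

definition circle_point :: "real \<Rightarrow> real ^ 2" where
  "circle_point \<theta> = vector [cos \<theta>, sin \<theta>]"

definition circle_tangent :: "real \<Rightarrow> real ^ 2" where
  "circle_tangent \<theta> = vector [- sin \<theta>, cos \<theta>]"

lemma inner_circle_point: "circle_point \<theta> \<bullet> v = cos \<theta> * v $ 1 + sin \<theta> * v $ 2"
  by (simp add: circle_point_def inner_vec_def sum_2)

lemma inner_circle_tangent: "circle_tangent \<theta> \<bullet> v = - sin \<theta> * v $ 1 + cos \<theta> * v $ 2"
  by (simp add: circle_tangent_def inner_vec_def sum_2)

lemma circle_point_inner_circle_point: "circle_point \<alpha> \<bullet> circle_point \<beta> = cos (\<alpha> - \<beta>)"
  unfolding inner_circle_point by (simp add: circle_point_def cos_diff)

lemma circle_tangent_inner_circle_tangent: "circle_tangent \<alpha> \<bullet> circle_tangent \<beta> = cos (\<alpha> - \<beta>)"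
  unfolding inner_circle_tangent by (simp add: circle_tangent_def cos_diff)

lemma circle_point_inner_circle_tangent: "circle_point \<alpha> \<bullet> circle_tangent \<beta> = sin (\<alpha> - \<beta>)"
  unfolding inner_circle_point by (simp add: circle_tangent_def sin_diff)

lemma norm_circle_point [simp]: "norm (circle_point \<theta>) = 1"
  by (simp add: norm_eq_sqrt_inner circle_point_inner_circle_point)

lemma norm_circle_tangent [simp]: "norm (circle_tangent \<theta>) = 1"
  by (simp add: norm_eq_sqrt_inner circle_tangent_inner_circle_tangent)

lemma circle_point_nonzero [simp]: "circle_point \<theta> \<noteq> 0"
  using norm_circle_point[of \<theta>] by (metis norm_zero zero_neq_one)

lemma circle_point_periodic [simp]: "circle_point (\<theta> + 2 * pi) = circle_point \<theta>"
  by (simp add: circle_point_def)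

lemma circle_tangent_periodic [simp]: "circle_tangent (\<theta> + 2 * pi) = circle_tangent \<theta>"
  by (simp add: circle_tangent_def)

lemma inner_circle_decomposition:
  "z \<bullet> v = (circle_point \<theta> \<bullet> z) * (circle_point \<theta> \<bullet> v) + (circle_tangent \<theta> \<bullet> z) * (circle_tangent \<theta> \<bullet> v)"
proof -
  have "(cos \<theta> * a + sin \<theta> * b) * (cos \<theta> * c + sin \<theta> * d) + (- sin \<theta> * a + cos \<theta> * b) * (- sin \<theta> * c + cos \<theta> * d)
     = ((cos \<theta>)\<^sup>2 + (sin \<theta>)\<^sup>2) * (a * c + b * d)" for a b c d :: real
    by (simp only: power2_eq_square) algebra
  then show ?thesis
    unfolding inner_circle_point inner_circle_tangent by (simp add: inner_vec_def sum_2)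
qed

lemma has_vector_derivative_circle_point:
  "(circle_point has_vector_derivative circle_tangent \<theta>) (at \<theta> within S)"
proof -
  have "((\<lambda>\<theta>. cos \<theta> *\<^sub>R axis 1 1 + sin \<theta> *\<^sub>R axis 2 1 :: real ^ 2) has_vector_derivative
     (- sin \<theta>) *\<^sub>R axis 1 1 + cos \<theta> *\<^sub>R axis 2 1) (at \<theta> within S)"
    by (auto intro!: derivative_eq_intros simp flip: has_real_derivative_iff_has_vector_derivative)
  moreover have "circle_point = (\<lambda>\<theta>. cos \<theta> *\<^sub>R axis 1 1 + sin \<theta> *\<^sub>R axis 2 1)"
    by (auto simp: circle_point_def vec_eq_iff forall_2 axis_def)
  moreover have "circle_tangent \<theta> = (- sin \<theta>) *\<^sub>R axis 1 1 + cos \<theta> *\<^sub>R axis 2 1"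
    by (auto simp: circle_tangent_def vec_eq_iff forall_2 axis_def)
  ultimately show ?thesis by simp
qed

lemma DERIV_inner_circle_point:
  "((\<lambda>\<theta>. circle_point \<theta> \<bullet> z) has_real_derivative circle_tangent \<theta> \<bullet> z) (at \<theta> within S)"
  unfolding inner_circle_point inner_circle_tangent
  by (auto intro!: derivative_eq_intros)

lemma DERIV_inner_circle_tangent:
  "((\<lambda>\<theta>. circle_tangent \<theta> \<bullet> z) has_real_derivative - (circle_point \<theta> \<bullet> z)) (at \<theta> within S)"
  unfolding inner_circle_point inner_circle_tangent
  by (auto intro!: derivative_eq_intros)

lemma continuous_on_circle_point: "continuous_on S circle_point"
  by (meson has_vector_derivative_circle_point continuous_on_vector_derivative)

lemma continuous_on_circle_tangent: "continuous_on S circle_tangent"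
proof -
  have eq: "circle_tangent = (\<lambda>\<theta>. circle_point (\<theta> + pi / 2))"
    by (simp add: fun_eq_iff circle_point_def circle_tangent_def cos_add sin_add)
  show ?thesis
    unfolding eq
    by (rule continuous_on_compose2[OF continuous_on_circle_point[of UNIV]]) (auto intro!: continuous_intros)
qed

lemma sphere_circle_pointE:
  assumes "v \<in> sphere (0 :: real ^ 2) 1"
  obtains \<theta> where "0 \<le> \<theta>" "\<theta> < 2 * pi" "v = circle_point \<theta>"
proof -
  have "(v $ 1)\<^sup>2 + (v $ 2)\<^sup>2 = 1"
    using assms by (simp add: norm_eq_1 inner_vec_def sum_2 power2_eq_square)
  then obtain \<theta> where "0 \<le> \<theta>" "\<theta> < 2 * pi" "v $ 1 = cos \<theta>" "v $ 2 = sin \<theta>"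
    using sincos_total_2pi by metis
  then show thesis using that by (simp add: circle_point_def vec_eq_iff forall_2)
qed

lemma circle_point_eq_imp_eq:
  assumes "circle_point \<alpha> = circle_point \<beta>" "\<bar>\<alpha> - \<beta>\<bar> < 2 * pi"
  shows "\<alpha> = \<beta>"
proof -
  have "cos \<alpha> = cos \<beta>" "sin \<alpha> = sin \<beta>" using assms(1)
    by (auto simp: circle_point_def vec_eq_iff forall_2)
  then obtain i :: int where i: "\<alpha> = \<beta> + 2 * pi * real_of_int i"
    using iffD1[OF sin_cos_eq_iff[of \<alpha> \<beta>]] by auto
  then have "2 * pi * \<bar>real_of_int i\<bar> < 2 * pi * 1" using assms(2) by (simp add: abs_mult)
  then have "\<bar>real_of_int i\<bar> < 1" by (subst (asm) mult_less_cancel_left_pos) auto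
  then have "i = 0" by linarith
  then show ?thesis using i by simp
qed

text \<open>Addition formulas at \<open>p + q\<close> and \<open>p - q\<close>. That a chord is
  parallel to the tangent at the mid angle links the monotonicity of normals to arc length in
  \<open>arclen_mono\<close>.\<close>

lemma circle_point_diff:
  "circle_point \<beta> - circle_point \<alpha> = (2 * sin ((\<beta> - \<alpha>) / 2)) *\<^sub>R circle_tangent ((\<alpha> + \<beta>) / 2)"
proof -
  define p q where "p = (\<alpha> + \<beta>) / 2" and "q = (\<beta> - \<alpha>) / 2"
  have "\<beta> = p + q" "\<alpha> = p - q" by (simp_all add: p_def q_def field_simps)
  then show ?thesis
    unfolding p_def[symmetric] q_def[symmetric]
    by (simp add: circle_point_def circle_tangent_def vec_eq_iff forall_2 cos_add cos_diff sin_add sin_diff)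
qed

section \<open>Support function and contact points in terms of the normal angle\<close>

locale planar_body =
  fixes K :: "(real ^ 2) set"
  assumes compact: "compact K" and convex: "convex K" and zero_interior: "0 \<in> interior K"
    and smooth: "smooth_body K" and strict: "strictly_convex K"
begin

definition supp :: "real \<Rightarrow> real" where
  "supp \<theta> = support_fun K (circle_point \<theta>)"

definition pt :: "real \<Rightarrow> real ^ 2" where
  "pt \<theta> = (THE y. y \<in> K \<and> circle_point \<theta> \<bullet> y = supp \<theta>)"

definition dsupp :: "real \<Rightarrow> real" where
  "dsupp \<theta> = circle_tangent \<theta> \<bullet> pt \<theta>"

text \<open>The arc length of the boundary curve \<open>pt\<close> up to an additive constant: the radius of
  curvature is \<open>supp'' + supp\<close>, and \<open>arclen\<close> is its primitive, which makes sense without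
  a second derivative.\<close>

definition arclen :: "real \<Rightarrow> real" where
  "arclen \<theta> = dsupp \<theta> + integral {0..\<theta>} supp"

text \<open>The closed interval is possible because \<open>arclen\<close> is injective there: unlike
  the boundary curve, the length tells the two ends apart.\<close>

definition angle :: "real \<Rightarrow> real" where
  "angle = the_inv_into {0..2 * pi} arclen"

lemma nonempty: "K \<noteq> {}"
  using zero_interior interior_subset by blast

text \<open>Compactness gives a contact point and strict convexity makes it unique, so the
  description in \<open>pt\<close> is proper.\<close>

lemma pt: "pt \<theta> \<in> K" "circle_point \<theta> \<bullet> pt \<theta> = supp \<theta>"
  and pt_unique: "\<lbrakk>y \<in> K; circle_point \<theta> \<bullet> y = supp \<theta>\<rbrakk> \<Longrightarrow> y = pt \<theta>"
proof -
  obtain z where z: "z \<in> K" "circle_point \<theta> \<bullet> z = supp \<theta>"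
    using support_fun_attained[OF compact nonempty] unfolding supp_def .
  have uniq: "x = y" if "x \<in> K" "y \<in> K" "circle_point \<theta> \<bullet> x = supp \<theta>" "circle_point \<theta> \<bullet> y = supp \<theta>" for x y
    using strictly_convex_support_point_unique[OF compact strict circle_point_nonzero] that unfolding supp_def by blast
  have "pt \<theta> \<in> K \<and> circle_point \<theta> \<bullet> pt \<theta> = supp \<theta>"
    unfolding pt_def by (rule theI[of _ z]) (use z uniq in blast)+
  then show 1: "pt \<theta> \<in> K" "circle_point \<theta> \<bullet> pt \<theta> = supp \<theta>" by auto
  show "y = pt \<theta>" if "y \<in> K" "circle_point \<theta> \<bullet> y = supp \<theta>" using uniq 1 that by blast
qed

lemma supp_upper: "y \<in> K \<Longrightarrow> circle_point \<theta> \<bullet> y \<le> supp \<theta>"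
  unfolding supp_def by (rule support_fun_upper[OF compact])

lemma supp_pos: "supp \<theta> > 0"
  unfolding supp_def by (rule support_fun_pos[OF compact zero_interior]) simp

lemma supp_periodic: "supp (\<theta> + 2 * pi) = supp \<theta>"
  by (simp add: supp_def)

lemma pt_periodic: "pt (\<theta> + 2 * pi) = pt \<theta>"
  by (simp add: pt_def supp_periodic)

lemma dsupp_periodic: "dsupp (\<theta> + 2 * pi) = dsupp \<theta>"
  by (simp add: dsupp_def pt_periodic)

lemma inner_pt: "z \<bullet> pt \<theta> = (circle_point \<theta> \<bullet> z) * supp \<theta> + (circle_tangent \<theta> \<bullet> z) * dsupp \<theta>"
  unfolding inner_circle_decomposition[of z "pt \<theta>" \<theta>] pt dsupp_def ..

lemma continuous_on_supp: "continuous_on S supp"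
  unfolding supp_def
  by (rule continuous_on_compose2[OF continuous_on_support_fun[OF compact nonempty, of UNIV] continuous_on_circle_point]) simp

text \<open>The graph is cut out by closed conditions and the values stay in the compact set
  \<open>K\<close>, so the closed graph theorem applies.\<close>

lemma continuous_on_pt: "continuous_on S pt"
proof -
  have "(\<lambda>\<theta>. (\<theta>, pt \<theta>)) ` UNIV = (UNIV \<times> K) \<inter> {p. circle_point (fst p) \<bullet> snd p = supp (fst p)}"
    using pt pt_unique by (force simp: image_iff)
  also have "closed \<dots>"
    by (intro closed_Int closed_Times closed_UNIV compact_imp_closed[OF compact] closed_Collect_eq
        continuous_intros continuous_on_compose2[OF continuous_on_supp[of UNIV]]
        continuous_on_compose2[OF continuous_on_circle_point[of UNIV]]) auto
  finally have "continuous_on UNIV pt"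
    by (intro continuous_from_closed_graph[OF compact]) (auto simp: pt)
  then show ?thesis by (rule continuous_on_subset) simp
qed

lemma continuous_on_dsupp: "continuous_on S dsupp"
  unfolding dsupp_def by (intro continuous_intros continuous_on_pt continuous_on_circle_tangent)

text \<open>An envelope argument: each of the two contact points competes in the other direction,
  which traps the increment of \<open>supp\<close> between two inner products with the same chord.
  They differ by a factor tending to 0, since \<open>pt\<close> is continuous.\<close>

lemma DERIV_supp: "(supp has_real_derivative dsupp \<theta>) (at \<theta>)"
proof -
  define q where "q y = (1 / (y - \<theta>)) *\<^sub>R (circle_point y - circle_point \<theta>)" for y
  have q: "(q \<longlongrightarrow> circle_tangent \<theta>) (at \<theta>)"
  proof -
    have lim: "((\<lambda>y. q y $ 1) \<longlongrightarrow> circle_tangent \<theta> $ 1) (at \<theta>)" "((\<lambda>y. q y $ 2) \<longlongrightarrow> circle_tangent \<theta> $ 2) (at \<theta>)"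
      using DERIV_cos[of \<theta>] DERIV_sin[of \<theta>] unfolding has_field_derivative_iff
      by (simp_all add: q_def circle_point_def circle_tangent_def)
    show ?thesis
    proof (rule vec_tendstoI)
      fix i :: 2
      show "((\<lambda>y. q y $ i) \<longlongrightarrow> circle_tangent \<theta> $ i) (at \<theta>)" using lim exhaust_2[of i] by auto
    qed
  qed
  have pt_lim: "(pt \<longlongrightarrow> pt \<theta>) (at \<theta>)"
    using continuous_on_pt[of UNIV] by (simp add: continuous_on_def)
  have "((\<lambda>y. (pt y - pt \<theta>) \<bullet> q y) \<longlongrightarrow> (pt \<theta> - pt \<theta>) \<bullet> circle_tangent \<theta>) (at \<theta>)"
    by (intro tendsto_intros pt_lim q)
  then have "((\<lambda>y. (pt y - pt \<theta>) \<bullet> q y) \<longlongrightarrow> 0) (at \<theta>)" by simp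
  then have lim0: "((\<lambda>y. \<bar>(pt y - pt \<theta>) \<bullet> q y\<bar>) \<longlongrightarrow> 0) (at \<theta>)"
    by (rule tendsto_rabs_zero)
  have "norm ((supp y - supp \<theta>) / (y - \<theta>) - pt \<theta> \<bullet> q y) \<le> \<bar>(pt y - pt \<theta>) \<bullet> q y\<bar>" if "y \<noteq> \<theta>" for y
  proof -
    let ?d = "circle_point y - circle_point \<theta>"
    have "pt \<theta> \<bullet> ?d \<le> supp y - supp \<theta>"
      using supp_upper[OF pt(1)[of \<theta>], of y] pt(2)[of \<theta>] by (simp add: inner_diff_right inner_commute)
    moreover have "supp y - supp \<theta> \<le> pt y \<bullet> ?d"
      using supp_upper[OF pt(1)[of y], of \<theta>] pt(2)[of y] by (simp add: inner_diff_right inner_commute)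
    ultimately have "\<bar>supp y - supp \<theta> - pt \<theta> \<bullet> ?d\<bar> \<le> \<bar>(pt y - pt \<theta>) \<bullet> ?d\<bar>"
      by (simp add: inner_diff_left)
    then have "\<bar>supp y - supp \<theta> - pt \<theta> \<bullet> ?d\<bar> / \<bar>y - \<theta>\<bar> \<le> \<bar>(pt y - pt \<theta>) \<bullet> ?d\<bar> / \<bar>y - \<theta>\<bar>"
      by (rule divide_right_mono) simp
    then show ?thesis by (simp add: q_def diff_divide_distrib flip: abs_divide)
  qed
  then have "\<forall>\<^sub>F y in at \<theta>. norm ((supp y - supp \<theta>) / (y - \<theta>) - pt \<theta> \<bullet> q y) \<le> \<bar>(pt y - pt \<theta>) \<bullet> q y\<bar>"
    unfolding eventually_at_filter by (intro always_eventually) blast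
  then have "((\<lambda>y. (supp y - supp \<theta>) / (y - \<theta>) - pt \<theta> \<bullet> q y) \<longlongrightarrow> 0) (at \<theta>)"
    using lim0 by (rule Lim_null_comparison)
  moreover have "((\<lambda>y. pt \<theta> \<bullet> q y) \<longlongrightarrow> dsupp \<theta>) (at \<theta>)"
    unfolding dsupp_def inner_commute[of "circle_tangent \<theta>"] by (intro tendsto_intros q)
  ultimately have "((\<lambda>y. (supp y - supp \<theta>) / (y - \<theta>) - pt \<theta> \<bullet> q y + pt \<theta> \<bullet> q y) \<longlongrightarrow> 0 + dsupp \<theta>) (at \<theta>)"
    by (rule tendsto_add)
  then show ?thesis by (simp add: has_field_derivative_iff)
qed

section \<open>Arc length and chords of the boundary curve\<close>

lemma DERIV_integral_supp:
  assumes "0 \<le> \<alpha>" "\<theta> \<in> {\<alpha>..\<beta>}"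
  shows "((\<lambda>x. integral {0..x} supp) has_real_derivative supp \<theta>) (at \<theta> within {\<alpha>..\<beta>})"
proof -
  have "((\<lambda>x. integral {0..x} supp) has_real_derivative supp \<theta>) (at \<theta> within {0..\<beta>})"
    using assms by (intro integral_has_real_derivative continuous_on_supp) auto
  then show ?thesis using assms(1) by (elim DERIV_subset) auto
qed

lemma continuous_on_arclen: "continuous_on {0..\<beta>} arclen"
  unfolding arclen_def[abs_def]
  by (intro continuous_intros continuous_on_dsupp DERIV_continuous_on[OF DERIV_integral_supp]) auto

text \<open>Formally \<open>pt\<close> has derivative \<open>arclen'\<close> times
  \<open>circle_tangent\<close>, and this is the integrated form after moving the derivative to the
  tangent. The explicit primitive \<open>A\<close> avoids differentiating \<open>arclen\<close>; the
  constant \<open>c\<close> is free because the integral of \<open>circle_point\<close> is a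
  difference of tangents.\<close>

lemma inner_pt_diff_integral:
  assumes "0 \<le> \<alpha>" "\<alpha> \<le> \<beta>"
  shows "z \<bullet> (pt \<beta> - pt \<alpha>) = (circle_tangent \<beta> \<bullet> z) * (arclen \<beta> - c) - (circle_tangent \<alpha> \<bullet> z) * (arclen \<alpha> - c)
     + integral {\<alpha>..\<beta>} (\<lambda>\<theta>. (circle_point \<theta> \<bullet> z) * (arclen \<theta> - c))"
proof -
  define A where "A \<theta> = (circle_point \<theta> \<bullet> z) * supp \<theta> - (circle_tangent \<theta> \<bullet> z) * (integral {0..\<theta>} supp - c)" for \<theta>
  have "((\<lambda>\<theta>. (circle_point \<theta> \<bullet> z) * (arclen \<theta> - c)) has_integral A \<beta> - A \<alpha>) {\<alpha>..\<beta>}"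
  proof (rule fundamental_theorem_of_calculus[OF assms(2)])
    fix \<theta> assume \<theta>: "\<theta> \<in> {\<alpha>..\<beta>}"
    show "(A has_vector_derivative (circle_point \<theta> \<bullet> z) * (arclen \<theta> - c)) (at \<theta> within {\<alpha>..\<beta>})"
      unfolding has_real_derivative_iff_has_vector_derivative[symmetric] A_def[abs_def]
      by (rule derivative_eq_intros DERIV_inner_circle_point DERIV_inner_circle_tangent
          has_field_derivative_at_within[OF DERIV_supp] DERIV_integral_supp[OF assms(1) \<theta>] refl)+
        (simp add: arclen_def algebra_simps)
  qed
  then have "integral {\<alpha>..\<beta>} (\<lambda>\<theta>. (circle_point \<theta> \<bullet> z) * (arclen \<theta> - c)) = A \<beta> - A \<alpha>"
    by (rule integral_unique)
  then show ?thesis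
    by (simp add: inner_diff_right inner_pt A_def arclen_def algebra_simps)
qed

text \<open>Contact points move monotonically with their normals. Near each point this gives a lower
  bound with an error \<open>\<epsilon>\<close> times the interval length; bisection makes the bound
  global, and then \<open>\<epsilon>\<close> tends to 0.\<close>

lemma arclen_mono:
  assumes "0 \<le> \<alpha>" "\<alpha> \<le> \<beta>"
  shows "arclen \<alpha> \<le> arclen \<beta>"
proof -
  have "- \<epsilon> * (\<beta> - \<alpha>) \<le> arclen \<beta> - arclen \<alpha>" if \<epsilon>: "\<epsilon> > 0" for \<epsilon>
  proof -
    have "0 \<le> \<alpha> \<longrightarrow> \<beta> \<le> \<beta> \<longrightarrow> - \<epsilon> * (\<beta> - \<alpha>) \<le> arclen \<beta> - arclen \<alpha>"
      using assms(2)
    proof (induction rule: Bolzano[where P = "\<lambda>u v. 0 \<le> u \<longrightarrow> v \<le> \<beta> \<longrightarrow> - \<epsilon> * (v - u) \<le> arclen v - arclen u"])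
      case (trans u v w)
      then show ?case by (auto simp: algebra_simps)
    next
      case (local x)
      then have x: "x \<in> {0..\<beta>}" using assms(1) by auto
      obtain d where d: "d > 0" "\<And>y. \<lbrakk>y \<in> {0..\<beta>}; dist y x < d\<rbrakk> \<Longrightarrow> dist (arclen y) (arclen x) < \<epsilon> / 2"
        using continuous_on_arclen[of \<beta>] x half_gt_zero[OF \<epsilon>] unfolding continuous_on_iff by meson
      have "- \<epsilon> * (v - u) \<le> arclen v - arclen u"
        if uv: "0 \<le> u" "u \<le> x" "x \<le> v" "v \<le> \<beta>" "v - u < min d 1" for u v
      proof (cases "u = v")
        case False
        define m k where "m = (u + v) / 2" and "k = (v - u) / 2"
        have mk: "v - m = k" "m - u = k" "u - m = - k" by (simp_all add: m_def k_def field_simps)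
        have k: "0 < k" "k < 1 / 2" using False uv by (auto simp: k_def)
        \<comment> \<open>Sum of two support inequalities, each testing one contact point in the
          other direction.\<close>
        have "0 \<le> (circle_point v - circle_point u) \<bullet> (pt v - pt u)"
          using supp_upper[OF pt(1)[of u], of v] supp_upper[OF pt(1)[of v], of u] pt(2)[of u] pt(2)[of v]
          by (simp add: inner_diff_left inner_diff_right)
        then have "0 \<le> (2 * sin k) * (circle_tangent m \<bullet> (pt v - pt u))"
          unfolding circle_point_diff by (simp add: m_def k_def)
        moreover have "sin k > 0" using k pi_gt3 by (intro sin_gt_zero) auto
        ultimately have "0 \<le> circle_tangent m \<bullet> (pt v - pt u)" by (simp add: zero_le_mult_iff)
        also have "\<dots> = cos k * (arclen v - arclen u)
            + integral {u..v} (\<lambda>\<theta>. (circle_point \<theta> \<bullet> circle_tangent m) * (arclen \<theta> - arclen x))"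
          using uv by (subst inner_pt_diff_integral[where c = "arclen x"])
            (auto simp: circle_tangent_inner_circle_tangent mk algebra_simps)
        also have "integral {u..v} (\<lambda>\<theta>. (circle_point \<theta> \<bullet> circle_tangent m) * (arclen \<theta> - arclen x))
            \<le> \<epsilon> / 2 * (v - u)"
        proof -
          have "norm (integral (cbox u v) (\<lambda>\<theta>. (circle_point \<theta> \<bullet> circle_tangent m) * (arclen \<theta> - arclen x)))
            \<le> \<epsilon> / 2 * measure lborel (cbox u v)"
          proof (rule integrable_bound)
            show "(\<lambda>\<theta>. (circle_point \<theta> \<bullet> circle_tangent m) * (arclen \<theta> - arclen x)) integrable_on cbox u v"
              using uv by (intro integrable_continuous continuous_intros continuous_on_circle_point
                  continuous_on_subset[OF continuous_on_arclen[of \<beta>]]) auto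
            fix \<theta> assume "\<theta> \<in> cbox u v"
            have "\<bar>arclen \<theta> - arclen x\<bar> \<le> \<epsilon> / 2"
            proof -
              have "\<theta> \<in> {u..v}" using \<open>\<theta> \<in> cbox u v\<close> by simp
              then have "\<theta> \<in> {0..\<beta>}" "dist \<theta> x < d" using uv by (auto simp: dist_real_def)
              then show ?thesis using d(2)[of \<theta>] by (simp add: dist_real_def)
            qed
            then have "\<bar>circle_point \<theta> \<bullet> circle_tangent m\<bar> * \<bar>arclen \<theta> - arclen x\<bar> \<le> 1 * (\<epsilon> / 2)"
              by (intro mult_mono) (auto simp: circle_point_inner_circle_tangent abs_sin_le_one)
            then show "norm ((circle_point \<theta> \<bullet> circle_tangent m) * (arclen \<theta> - arclen x)) \<le> \<epsilon> / 2"
              by (simp add: abs_mult)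
          qed (use \<epsilon> in simp)
          then show ?thesis using uv by simp
        qed
        finally have "- (\<epsilon> / 2 * (v - u)) \<le> cos k * (arclen v - arclen u)" by simp
        moreover have "1 / 2 \<le> cos k"
          using k pi_gt3 by (subst cos_60[symmetric], intro cos_monotone_0_pi_le) auto
        \<comment> \<open>If the increment is negative, dividing by \<open>cos k \<ge> 1 / 2\<close>
          costs a factor of at most 2; this is why continuity was used with
          \<open>\<epsilon> / 2\<close>.\<close>
        ultimately show ?thesis
        proof (cases "arclen v - arclen u \<ge> 0")
          case True
          have "- \<epsilon> * (v - u) \<le> 0" using \<epsilon> uv by simp
          then show ?thesis using True by linarith
        next
          case neg: False
          have "cos k * (arclen v - arclen u) \<le> 1 / 2 * (arclen v - arclen u)"
            using neg \<open>1 / 2 \<le> cos k\<close> by (intro mult_right_mono_neg) auto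
          then have "- (\<epsilon> * (v - u) / 2) \<le> (arclen v - arclen u) / 2"
            using \<open>- (\<epsilon> / 2 * (v - u)) \<le> _\<close> by simp
          moreover have "- p \<le> q" if "- (p / 2) \<le> q / 2" for p q :: real using that by simp
          ultimately have "- (\<epsilon> * (v - u)) \<le> arclen v - arclen u" by blast
          then show ?thesis by simp
        qed
      qed simp
      then show ?case using d(1) by (intro exI[of _ "min d 1"]) auto
    qed
    then show ?thesis using assms(1) by simp
  qed
  note * = this
  have "((\<lambda>\<epsilon>::real. - \<epsilon> * (\<beta> - \<alpha>)) \<longlongrightarrow> - 0 * (\<beta> - \<alpha>)) (at_right 0)"
    by (intro tendsto_intros)
  moreover have "\<forall>\<^sub>F \<epsilon> in at_right 0. - \<epsilon> * (\<beta> - \<alpha>) \<le> arclen \<beta> - arclen \<alpha>"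
    unfolding eventually_at_right_field using * by (intro exI[of _ 1]) auto
  ultimately have "- 0 * (\<beta> - \<alpha>) \<le> arclen \<beta> - arclen \<alpha>"
    by (rule tendsto_upperbound) (rule trivial_limit_at_right_real)
  then show ?thesis by simp
qed

lemma inner_pt_diff:
  assumes "0 \<le> \<alpha>" "\<alpha> \<le> \<beta>"
  shows "z \<bullet> (pt \<beta> - pt \<alpha>) = (circle_tangent \<beta> \<bullet> z) * (arclen \<beta> - arclen \<alpha>)
     + integral {\<alpha>..\<beta>} (\<lambda>\<theta>. (circle_point \<theta> \<bullet> z) * (arclen \<theta> - arclen \<alpha>))"
  using inner_pt_diff_integral[OF assms, of z "arclen \<alpha>"] by simp

text \<open>Test the integral formula with the unit vector along the chord: by monotonicity of
  \<open>arclen\<close> the integrand is at most the total increment. For a degenerate chord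
  \<open>sgn\<close> gives the zero vector.\<close>

lemma norm_pt_diff_le:
  assumes "0 \<le> \<alpha>" "\<alpha> \<le> \<beta>"
  shows "norm (pt \<beta> - pt \<alpha>) \<le> (1 + (\<beta> - \<alpha>)) * (arclen \<beta> - arclen \<alpha>)"
proof -
  define z where "z = sgn (pt \<beta> - pt \<alpha>)"
  have z1: "norm z \<le> 1" by (simp add: z_def norm_sgn)
  have cs: "\<bar>x \<bullet> z\<bar> \<le> 1" if "norm x = 1" for x
    using Cauchy_Schwarz_ineq2[of x z] that z1 by simp
  have "norm (pt \<beta> - pt \<alpha>) = z \<bullet> (pt \<beta> - pt \<alpha>)"
    by (cases "pt \<beta> = pt \<alpha>") (simp_all add: z_def sgn_div_norm dot_square_norm power2_eq_square)
  also have "\<dots> = (circle_tangent \<beta> \<bullet> z) * (arclen \<beta> - arclen \<alpha>)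
     + integral {\<alpha>..\<beta>} (\<lambda>\<theta>. (circle_point \<theta> \<bullet> z) * (arclen \<theta> - arclen \<alpha>))"
    by (rule inner_pt_diff[OF assms])
  also have "(circle_tangent \<beta> \<bullet> z) * (arclen \<beta> - arclen \<alpha>) \<le> 1 * (arclen \<beta> - arclen \<alpha>)"
    using cs[of "circle_tangent \<beta>"] arclen_mono[OF assms] by (intro mult_right_mono) auto
  also have "integral {\<alpha>..\<beta>} (\<lambda>\<theta>. (circle_point \<theta> \<bullet> z) * (arclen \<theta> - arclen \<alpha>))
      \<le> (arclen \<beta> - arclen \<alpha>) * (\<beta> - \<alpha>)"
  proof -
    have "norm (integral (cbox \<alpha> \<beta>) (\<lambda>\<theta>. (circle_point \<theta> \<bullet> z) * (arclen \<theta> - arclen \<alpha>)))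
      \<le> (arclen \<beta> - arclen \<alpha>) * measure lborel (cbox \<alpha> \<beta>)"
    proof (rule integrable_bound)
      show "(\<lambda>\<theta>. (circle_point \<theta> \<bullet> z) * (arclen \<theta> - arclen \<alpha>)) integrable_on cbox \<alpha> \<beta>"
        using assms by (intro integrable_continuous continuous_intros continuous_on_circle_point
            continuous_on_subset[OF continuous_on_arclen[of \<beta>]]) auto
      fix \<theta> assume \<theta>: "\<theta> \<in> cbox \<alpha> \<beta>"
      then have "0 \<le> arclen \<theta> - arclen \<alpha>" "arclen \<theta> - arclen \<alpha> \<le> arclen \<beta> - arclen \<alpha>"
        using arclen_mono assms by auto
      then have "\<bar>circle_point \<theta> \<bullet> z\<bar> * \<bar>arclen \<theta> - arclen \<alpha>\<bar> \<le> 1 * (arclen \<beta> - arclen \<alpha>)"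
        using cs[of "circle_point \<theta>"] by (intro mult_mono) auto
      then show "norm ((circle_point \<theta> \<bullet> z) * (arclen \<theta> - arclen \<alpha>)) \<le> arclen \<beta> - arclen \<alpha>"
        by (simp add: abs_mult)
    qed (use arclen_mono[OF assms] in simp)
    then show ?thesis using assms by simp
  qed
  finally show ?thesis by (simp add: algebra_simps)
qed

lemma norm_pt_diff_ge:
  assumes "0 \<le> \<alpha>" "\<alpha> \<le> \<beta>" "\<beta> - \<alpha> \<le> pi"
  shows "cos (\<beta> - \<alpha>) * (arclen \<beta> - arclen \<alpha>) \<le> norm (pt \<beta> - pt \<alpha>)"
proof -
  have "0 \<le> integral {\<alpha>..\<beta>} (\<lambda>\<theta>. (circle_point \<theta> \<bullet> circle_tangent \<alpha>) * (arclen \<theta> - arclen \<alpha>))"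
  proof (rule integral_nonneg)
    show "(\<lambda>\<theta>. (circle_point \<theta> \<bullet> circle_tangent \<alpha>) * (arclen \<theta> - arclen \<alpha>)) integrable_on {\<alpha>..\<beta>}"
      using assms by (intro integrable_continuous_real continuous_intros continuous_on_circle_point
          continuous_on_subset[OF continuous_on_arclen[of \<beta>]]) auto
    fix \<theta> assume \<theta>: "\<theta> \<in> {\<alpha>..\<beta>}"
    then have "0 \<le> sin (\<theta> - \<alpha>)" "0 \<le> arclen \<theta> - arclen \<alpha>"
      using assms arclen_mono by (auto intro: sin_ge_zero)
    then show "0 \<le> (circle_point \<theta> \<bullet> circle_tangent \<alpha>) * (arclen \<theta> - arclen \<alpha>)"
      by (simp add: circle_point_inner_circle_tangent)
  qed
  then have "cos (\<beta> - \<alpha>) * (arclen \<beta> - arclen \<alpha>) \<le> circle_tangent \<alpha> \<bullet> (pt \<beta> - pt \<alpha>)"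
    unfolding inner_pt_diff[OF assms(1,2)] by (simp add: circle_tangent_inner_circle_tangent)
  also have "\<dots> \<le> norm (pt \<beta> - pt \<alpha>)"
    using norm_cauchy_schwarz[of "circle_tangent \<alpha>" "pt \<beta> - pt \<alpha>"] by simp
  finally show ?thesis .
qed

section \<open>The boundary parametrised by arc length\<close>

lemma pt_in_frontier: "pt \<theta> \<in> frontier K"
  using pt by (intro support_point_in_frontier[OF compact, where u = "circle_point \<theta>"]) (auto simp: supp_def)

text \<open>Smoothness enters here: both angles give outer unit normals at the same boundary
  point.\<close>

lemma pt_eq_imp_eq:
  assumes "pt \<alpha> = pt \<beta>" "\<bar>\<alpha> - \<beta>\<bar> < 2 * pi"
  shows "\<alpha> = \<beta>"
proof -
  have "outer_unit_normal K (pt \<alpha>) (circle_point \<alpha>)" "outer_unit_normal K (pt \<alpha>) (circle_point \<beta>)"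
    using pt[of \<alpha>] pt[of \<beta>] assms(1) by (auto simp: outer_unit_normal_iff_support_fun[OF compact] supp_def)
  then have "circle_point \<alpha> = circle_point \<beta>"
    using smooth pt_in_frontier unfolding smooth_body_def by blast
  then show ?thesis using assms(2) by (rule circle_point_eq_imp_eq)
qed

text \<open>If no length is gained, the upper chord bound makes two contact points coincide. Cutting
  the interval down to length at most 1 keeps their angles less than a full turn apart.\<close>

lemma arclen_strict_mono:
  assumes "0 \<le> \<alpha>" "\<alpha> < \<beta>"
  shows "arclen \<alpha> < arclen \<beta>"
proof (rule ccontr)
  assume "\<not> arclen \<alpha> < arclen \<beta>"
  moreover define \<gamma> where "\<gamma> = min \<beta> (\<alpha> + 1)"
  have \<gamma>: "\<alpha> < \<gamma>" "\<gamma> \<le> \<beta>" "\<gamma> - \<alpha> \<le> 1" using assms by (auto simp: \<gamma>_def)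
  ultimately have "arclen \<gamma> = arclen \<alpha>"
    using arclen_mono[of \<alpha> \<gamma>] arclen_mono[of \<gamma> \<beta>] assms by auto
  then have "pt \<gamma> = pt \<alpha>" using norm_pt_diff_le[of \<alpha> \<gamma>] assms \<gamma> by simp
  then show False using pt_eq_imp_eq[of \<gamma> \<alpha>] \<gamma> pi_gt3 by simp
qed

lemma inj_on_arclen: "inj_on arclen {0..2 * pi}"
proof (rule inj_onI)
  fix \<alpha> \<beta> :: real assume "\<alpha> \<in> {0..2 * pi}" "\<beta> \<in> {0..2 * pi}" "arclen \<alpha> = arclen \<beta>"
  then show "\<alpha> = \<beta>"
    using arclen_strict_mono[of \<alpha> \<beta>] arclen_strict_mono[of \<beta> \<alpha>] by (cases \<alpha> \<beta> rule: linorder_cases) auto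
qed

lemma arclen_image: "arclen ` {0..2 * pi} = {arclen 0..arclen (2 * pi)}"
proof
  show "{arclen 0..arclen (2 * pi)} \<subseteq> arclen ` {0..2 * pi}"
  proof
    fix s assume "s \<in> {arclen 0..arclen (2 * pi)}"
    then have "\<exists>\<theta>\<ge>0. \<theta> \<le> 2 * pi \<and> arclen \<theta> = s"
      by (intro IVT' continuous_on_arclen) auto
    then show "s \<in> arclen ` {0..2 * pi}" by auto
  qed
  show "arclen ` {0..2 * pi} \<subseteq> {arclen 0..arclen (2 * pi)}"
  proof clarify
    fix \<theta> :: real assume "\<theta> \<in> {0..2 * pi}"
    then show "arclen \<theta> \<in> {arclen 0..arclen (2 * pi)}"
      using arclen_mono[of 0 \<theta>] arclen_mono[of \<theta> "2 * pi"] by simp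
  qed
qed

lemma angle_arclen: "\<theta> \<in> {0..2 * pi} \<Longrightarrow> angle (arclen \<theta>) = \<theta>"
  unfolding angle_def by (rule the_inv_into_f_f[OF inj_on_arclen])

lemma angle: "s \<in> {arclen 0..arclen (2 * pi)} \<Longrightarrow> angle s \<in> {0..2 * pi} \<and> arclen (angle s) = s"
  using angle_arclen unfolding arclen_image[symmetric] by auto

lemma angle_less: "s \<in> {arclen 0..<arclen (2 * pi)} \<Longrightarrow> angle s < 2 * pi"
  using angle[of s] by (cases "angle s = 2 * pi") auto

lemma angle_mono: "\<lbrakk>s \<in> {arclen 0..arclen (2 * pi)}; t \<in> {arclen 0..arclen (2 * pi)}; s \<le> t\<rbrakk> \<Longrightarrow> angle s \<le> angle t"
  using angle[of s] angle[of t] arclen_strict_mono[of "angle t" "angle s"] by (cases "angle s \<le> angle t") auto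

lemma continuous_on_angle: "continuous_on {arclen 0..arclen (2 * pi)} angle"
  unfolding arclen_image[symmetric]
  by (intro continuous_on_inv continuous_on_arclen) (auto simp: angle_arclen)

lemma arclen_0_less: "arclen 0 < arclen (2 * pi)"
  by (intro arclen_strict_mono) auto

text \<open>The two chord bounds have factors \<open>cos (\<beta> - \<alpha>)\<close> and
  \<open>1 + (\<beta> - \<alpha>)\<close>, which tend to 1 uniformly because \<open>angle\<close> is
  uniformly continuous.\<close>

lemma near_isometry_boundary: "near_isometry_on {arclen 0..arclen (2 * pi)} (\<lambda>s. pt (angle s))"
  unfolding near_isometry_on_def
proof (intro allI impI)
  fix \<epsilon> :: real assume \<epsilon>: "\<epsilon> > 0"
  have "isCont cos (0::real)" by simp
  then obtain \<kappa>0 where \<kappa>0: "\<kappa>0 > 0" "\<And>x::real. \<bar>x\<bar> < \<kappa>0 \<Longrightarrow> \<bar>cos x - 1\<bar> < \<epsilon>"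
    using \<epsilon> unfolding continuous_at_eps_delta dist_real_def by fastforce
  \<comment> \<open>\<open>\<kappa>0\<close> controls the cosine, \<open>\<epsilon>\<close> the
    upper factor, and 1 keeps the angle below pi for the lower chord bound.\<close>
  define \<kappa> where "\<kappa> = min \<kappa>0 (min \<epsilon> 1)"
  have "\<kappa> > 0" using \<kappa>0 \<epsilon> by (simp add: \<kappa>_def)
  moreover have "uniformly_continuous_on {arclen 0..arclen (2 * pi)} angle"
    by (intro compact_uniformly_continuous continuous_on_angle) simp
  ultimately obtain \<eta> where \<eta>: "\<eta> > 0"
    "\<And>s t. \<lbrakk>s \<in> {arclen 0..arclen (2 * pi)}; t \<in> {arclen 0..arclen (2 * pi)}; dist t s < \<eta>\<rbrakk> \<Longrightarrow> dist (angle t) (angle s) < \<kappa>"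
    unfolding uniformly_continuous_on_def by meson
  have le: "(1 - \<epsilon>) * dist s t \<le> dist (pt (angle s)) (pt (angle t)) \<and>
        dist (pt (angle s)) (pt (angle t)) \<le> (1 + \<epsilon>) * dist s t"
    if st: "s \<in> {arclen 0..arclen (2 * pi)}" "t \<in> {arclen 0..arclen (2 * pi)}" "dist s t < \<eta>" "s \<le> t" for s t
  proof -
    define \<alpha> \<beta> where "\<alpha> = angle s" and "\<beta> = angle t"
    have ab: "0 \<le> \<alpha>" "\<alpha> \<le> \<beta>" "arclen \<alpha> = s" "arclen \<beta> = t"
      using angle[OF st(1)] angle[OF st(2)] angle_mono[OF st(1,2,4)] by (auto simp: \<alpha>_def \<beta>_def)
    have "\<beta> - \<alpha> < \<kappa>" using \<eta>(2)[OF st(1,2)] st(3) ab(2) by (simp add: \<alpha>_def \<beta>_def dist_real_def)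
    then have small: "\<beta> - \<alpha> < \<kappa>0" "\<beta> - \<alpha> < \<epsilon>" "\<beta> - \<alpha> < 1" by (auto simp: \<kappa>_def)
    have "1 - \<epsilon> \<le> cos (\<beta> - \<alpha>)" using \<kappa>0(2)[of "\<beta> - \<alpha>"] small ab(2) by (auto simp: abs_if split: if_splits)
    then have "(1 - \<epsilon>) * (t - s) \<le> cos (\<beta> - \<alpha>) * (t - s)" using st(4) by (intro mult_right_mono) auto
    also have "\<dots> \<le> norm (pt \<beta> - pt \<alpha>)" using norm_pt_diff_ge[OF ab(1,2)] ab small pi_gt3 by simp
    finally have 1: "(1 - \<epsilon>) * (t - s) \<le> norm (pt \<beta> - pt \<alpha>)" .
    have "norm (pt \<beta> - pt \<alpha>) \<le> (1 + (\<beta> - \<alpha>)) * (t - s)" using norm_pt_diff_le[OF ab(1,2)] ab by simp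
    also have "\<dots> \<le> (1 + \<epsilon>) * (t - s)" using small st(4) by (intro mult_right_mono) auto
    finally show ?thesis using 1 st(4)
      by (simp add: \<alpha>_def \<beta>_def dist_norm norm_minus_commute abs_minus_commute)
  qed
  have "(1 - \<epsilon>) * dist s t \<le> dist (pt (angle s)) (pt (angle t)) \<and>
        dist (pt (angle s)) (pt (angle t)) \<le> (1 + \<epsilon>) * dist s t"
    if st: "s \<in> {arclen 0..arclen (2 * pi)}" "t \<in> {arclen 0..arclen (2 * pi)}" "dist s t < \<eta>" for s t
    using le[of s t] le[of t s] st by (cases "s \<le> t") (auto simp: dist_commute)
  then show "\<exists>\<eta>>0. \<forall>s\<in>{arclen 0..arclen (2 * pi)}. \<forall>t\<in>{arclen 0..arclen (2 * pi)}. dist s t < \<eta> \<longrightarrow>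
     (1 - \<epsilon>) * dist s t \<le> dist (pt (angle s)) (pt (angle t)) \<and>
     dist (pt (angle s)) (pt (angle t)) \<le> (1 + \<epsilon>) * dist s t"
    using \<eta>(1) by blast
qed

lemma inj_on_boundary: "inj_on (\<lambda>s. pt (angle s)) {arclen 0..<arclen (2 * pi)}"
proof (rule inj_onI)
  fix s t assume st: "s \<in> {arclen 0..<arclen (2 * pi)}" "t \<in> {arclen 0..<arclen (2 * pi)}" "pt (angle s) = pt (angle t)"
  have "angle s = angle t"
  proof (rule pt_eq_imp_eq[OF st(3)])
    have "0 \<le> angle s" "0 \<le> angle t" using angle[of s] angle[of t] st(1,2) by simp_all
    then show "\<bar>angle s - angle t\<bar> < 2 * pi" using angle_less[OF st(1)] angle_less[OF st(2)] by linarith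
  qed
  moreover have "arclen (angle s) = s" "arclen (angle t) = t" using angle[of s] angle[of t] st(1,2) by simp_all
  ultimately show "s = t" by metis
qed

end

subsection \<open>Surface area and cone-volume measure\<close>

text \<open>The right endpoint is a null set. The half-open interval parametrises the closed curve
  once, while the closed one suits continuity arguments.\<close>

lemma nn_integral_interval_eq_integral:
  fixes f :: "real \<Rightarrow> real"
  assumes "continuous_on {a..b} f" "\<And>s. s \<in> {a..b} \<Longrightarrow> f s \<ge> 0"
  shows "(\<integral>\<^sup>+ s. ennreal (f s) * indicator {a..<b} s \<partial>lborel) = ennreal (integral {a..b} f)"
proof -
  have "(\<integral>\<^sup>+ s. ennreal (f s) * indicator {a..<b} s \<partial>lborel) = (\<integral>\<^sup>+ s. ennreal (f s * indicator {a..b} s) \<partial>lborel)"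
  proof (rule nn_integral_cong_AE)
    have "AE s in lborel. s \<noteq> b" by (rule AE_lborel_singleton)
    then show "AE s in lborel. ennreal (f s) * indicator {a..<b} s = ennreal (f s * indicator {a..b} s)"
      by eventually_elim (auto simp: indicator_def)
  qed
  also have "\<dots> = ennreal (integral {a..b} f)"
  proof (rule nn_integral_has_integral_lborel)
    show "(\<lambda>s. f s * indicator {a..b} s) \<in> borel_measurable borel"
      using borel_measurable_continuous_on_indicator[OF _ assms(1)] by (simp add: mult.commute)
    have "(f has_integral integral {a..b} f) {a..b}"
      by (intro integrable_integral integrable_continuous_real assms(1))
    moreover have "(\<lambda>s. f s * indicator {a..b} s) = (\<lambda>s. if s \<in> {a..b} then f s else 0)"
      by (auto simp: indicator_def)
    ultimately show "((\<lambda>s. f s * indicator {a..b} s) has_integral integral {a..b} f) UNIV"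
      by (simp only: has_integral_restrict_UNIV)
  qed (use assms(2) in \<open>auto simp: indicator_def\<close>)
  finally show ?thesis .
qed

context planar_body
begin

lemma circle_point_angle_measurable:
  "(\<lambda>s. circle_point (angle s)) \<in>
     restrict_space lborel {arclen 0..<arclen (2 * pi)} \<rightarrow>\<^sub>M restrict_space borel (sphere 0 1)"
proof (rule measurable_restrict_space2)
  have "continuous_on {arclen 0..<arclen (2 * pi)} (\<lambda>s. circle_point (angle s))"
    by (rule continuous_on_compose2[OF continuous_on_circle_point[of UNIV] continuous_on_subset[OF continuous_on_angle]]) auto
  then have "(\<lambda>s. circle_point (angle s)) \<in> borel_measurable (restrict_space borel {arclen 0..<arclen (2 * pi)})"
    by (rule borel_measurable_continuous_on_restrict)
  moreover have "sets (restrict_space lborel {arclen 0..<arclen (2 * pi)}) = sets (restrict_space borel {arclen 0..<arclen (2 * pi)})"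
    by (rule sets_restrict_space_cong) simp
  ultimately show "(\<lambda>s. circle_point (angle s)) \<in> restrict_space lborel {arclen 0..<arclen (2 * pi)} \<rightarrow>\<^sub>M borel"
    by (simp cong: measurable_cong_sets)
qed auto

text \<open>Each normal is some \<open>circle_point \<theta>\<close> with \<open>\<theta>\<close> in
  a half-open period, and by strict convexity \<open>pt \<theta>\<close> is the only point where it
  occurs.\<close>

lemma reverse_spherical_image_eq:
  "reverse_spherical_image K \<omega> =
     (\<lambda>s. pt (angle s)) ` {s \<in> {arclen 0..<arclen (2 * pi)}. circle_point (angle s) \<in> \<omega>}"
proof (intro equalityI subsetI)
  fix y assume "y \<in> reverse_spherical_image K \<omega>"
  then obtain u where u: "y \<in> frontier K" "u \<in> \<omega>" "outer_unit_normal K y u"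
    unfolding reverse_spherical_image_def by auto
  have y: "y \<in> K" using u(1) compact by (simp add: frontier_def compact_imp_closed)
  have "norm u = 1" "u \<bullet> y = support_fun K u"
    using u(3) by (simp_all add: outer_unit_normal_iff_support_fun[OF compact y])
  moreover from this obtain \<theta> where \<theta>: "0 \<le> \<theta>" "\<theta> < 2 * pi" "u = circle_point \<theta>"
    using sphere_circle_pointE[of u] by auto
  ultimately have "y = pt \<theta>" using pt_unique[OF y] by (simp add: supp_def)
  moreover have "angle (arclen \<theta>) = \<theta>" using \<theta> by (intro angle_arclen) auto
  moreover have "arclen \<theta> \<in> {arclen 0..<arclen (2 * pi)}"
    using \<theta> arclen_mono[of 0 \<theta>] arclen_strict_mono[of \<theta> "2 * pi"] by simp
  ultimately show "y \<in> (\<lambda>s. pt (angle s)) ` {s \<in> {arclen 0..<arclen (2 * pi)}. circle_point (angle s) \<in> \<omega>}"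
    using u(2) \<theta>(3) by (intro image_eqI[of _ _ "arclen \<theta>"]) auto
next
  fix y assume "y \<in> (\<lambda>s. pt (angle s)) ` {s \<in> {arclen 0..<arclen (2 * pi)}. circle_point (angle s) \<in> \<omega>}"
  then obtain \<theta> where "y = pt \<theta>" "circle_point \<theta> \<in> \<omega>" by auto
  moreover have "outer_unit_normal K (pt \<theta>) (circle_point \<theta>)"
    using pt[of \<theta>] by (simp add: outer_unit_normal_iff_support_fun[OF compact] supp_def)
  ultimately show "y \<in> reverse_spherical_image K \<omega>"
    using pt_in_frontier unfolding reverse_spherical_image_def by auto
qed

text \<open>By \<open>hausdorff_eq_lborel\<close> the defining set function agrees on measurable
  sets with an image of Lebesgue measure. It is therefore a genuine measure, and
  \<open>measure_of\<close> returns it.\<close>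

lemma surface_area_measure_eq_distr:
  "surface_area_measure K =
     distr (restrict_space lborel {arclen 0..<arclen (2 * pi)}) (restrict_space borel (sphere 0 1)) (\<lambda>s. circle_point (angle s))"
    (is "_ = ?M")
proof -
  let ?\<mu> = "\<lambda>\<omega>. hausdorff_outer_measure (DIM(real ^ 2) - 1) (reverse_spherical_image K \<omega>)"
  have eq: "?\<mu> \<omega> = emeasure ?M \<omega>" if \<omega>: "\<omega> \<in> sets (restrict_space borel (sphere 0 1))" for \<omega>
  proof -
    define B where "B = {s \<in> {arclen 0..<arclen (2 * pi)}. circle_point (angle s) \<in> \<omega>}"
    have B_eq: "(\<lambda>s. circle_point (angle s)) -` \<omega> \<inter> space (restrict_space lborel {arclen 0..<arclen (2 * pi)}) = B"
      by (auto simp: B_def space_restrict_space)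
    have "B \<in> sets (restrict_space lborel {arclen 0..<arclen (2 * pi)})"
      unfolding B_eq[symmetric] by (rule measurable_sets[OF circle_point_angle_measurable \<omega>])
    then have B: "B \<in> sets borel" by (auto simp: sets_restrict_space_iff)
    have "emeasure ?M \<omega> = emeasure (restrict_space lborel {arclen 0..<arclen (2 * pi)}) B"
      unfolding B_eq[symmetric] by (rule emeasure_distr[OF circle_point_angle_measurable \<omega>])
    also have "\<dots> = emeasure lborel B"
      by (rule emeasure_restrict_space) (auto simp: B_def)
    also have "\<dots> = hausdorff_outer_measure 1 ((\<lambda>s. pt (angle s)) ` B)"
      by (rule hausdorff_eq_lborel[OF near_isometry_boundary arclen_0_less inj_on_boundary _ B, symmetric])
        (auto simp: B_def)
    also have "\<dots> = ?\<mu> \<omega>" by (simp add: reverse_spherical_image_eq B_def)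
    finally show ?thesis ..
  qed
  have "surface_area_measure K = measure_of (sphere 0 1) (sets (restrict_space borel (sphere 0 1))) (emeasure ?M)"
    unfolding surface_area_measure_def
  proof (rule measure_of_eq)
    show "sets (restrict_space borel (sphere (0 :: real ^ 2) 1)) \<subseteq> Pow (sphere 0 1)"
      using sets.space_closed[of "restrict_space borel (sphere (0 :: real ^ 2) 1)"] by (simp add: space_restrict_space)
    fix \<omega> assume "\<omega> \<in> sigma_sets (sphere (0 :: real ^ 2) 1) (sets (restrict_space borel (sphere 0 1)))"
    then have "\<omega> \<in> sets (restrict_space borel (sphere 0 1))"
      using sets.sigma_sets_eq[of "restrict_space borel (sphere (0 :: real ^ 2) 1)"] by (simp add: space_restrict_space)
    then show "?\<mu> \<omega> = emeasure ?M \<omega>" by (rule eq)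
  qed
  also have "\<dots> = measure_of (space ?M) (sets ?M) (emeasure ?M)" by (simp add: space_restrict_space)
  also have "\<dots> = ?M" by (rule measure_of_of_measure)
  finally show ?thesis .
qed

text \<open>Unfolds density and image measure into a real integral over arc length, the form to
  which \<open>integral_angle\<close> applies.\<close>

lemma nn_integral_cone_volume_measure:
  assumes g: "continuous_on (sphere 0 1) g" "\<And>u. u \<in> sphere 0 1 \<Longrightarrow> g u \<ge> 0"
  shows "(\<integral>\<^sup>+ u. ennreal (g u) \<partial>cone_volume_measure K) =
    ennreal (integral {arclen 0..arclen (2 * pi)} (\<lambda>s. supp (angle s) / 2 * g (circle_point (angle s))))"
proof -
  let ?S = "restrict_space borel (sphere (0 :: real ^ 2) 1)"
  have sets_S: "sets (surface_area_measure K) = sets ?S"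
    by (simp add: surface_area_measure_eq_distr)
  have "continuous_on (sphere 0 1) (\<lambda>u. support_fun K u / real DIM(real ^ 2))"
    by (intro continuous_intros continuous_on_support_fun[OF compact nonempty]) auto
  then have h_meas: "(\<lambda>u. ennreal (support_fun K u / real DIM(real ^ 2))) \<in> borel_measurable ?S"
    by (intro measurable_compose[OF borel_measurable_continuous_on_restrict measurable_ennreal])
  have g_meas: "(\<lambda>u. ennreal (g u)) \<in> borel_measurable ?S"
    by (intro measurable_compose[OF borel_measurable_continuous_on_restrict[OF g(1)] measurable_ennreal])
  have "(\<integral>\<^sup>+ u. ennreal (g u) \<partial>cone_volume_measure K) =
      (\<integral>\<^sup>+ u. ennreal (support_fun K u / real DIM(real ^ 2)) * ennreal (g u) \<partial>surface_area_measure K)"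
    unfolding cone_volume_measure_def using h_meas g_meas
    by (intro nn_integral_density) (simp_all cong: measurable_cong_sets add: sets_S)
  also have "\<dots> = (\<integral>\<^sup>+ s. ennreal (supp (angle s) / 2) * ennreal (g (circle_point (angle s)))
      \<partial>restrict_space lborel {arclen 0..<arclen (2 * pi)})"
    unfolding surface_area_measure_eq_distr
    using h_meas g_meas by (subst nn_integral_distr[OF circle_point_angle_measurable]) (simp_all add: supp_def)
  also have "\<dots> = (\<integral>\<^sup>+ s. ennreal (supp (angle s) / 2) * ennreal (g (circle_point (angle s)))
      * indicator {arclen 0..<arclen (2 * pi)} s \<partial>lborel)"
    by (rule nn_integral_restrict_space) simp
  also have "\<dots> = (\<integral>\<^sup>+ s. ennreal (supp (angle s) / 2 * g (circle_point (angle s)))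
      * indicator {arclen 0..<arclen (2 * pi)} s \<partial>lborel)"
    using supp_pos[THEN less_imp_le] g(2) by (intro nn_integral_cong arg_cong2[where f = "(*)"] ennreal_mult[symmetric]) auto
  also have "\<dots> = ennreal (integral {arclen 0..arclen (2 * pi)} (\<lambda>s. supp (angle s) / 2 * g (circle_point (angle s))))"
  proof (rule nn_integral_interval_eq_integral)
    show "continuous_on {arclen 0..arclen (2 * pi)} (\<lambda>s. supp (angle s) / 2 * g (circle_point (angle s)))"
      by (intro continuous_intros continuous_on_compose2[OF continuous_on_supp[of UNIV] continuous_on_angle]
          continuous_on_compose2[OF g(1)] continuous_on_compose2[OF continuous_on_circle_point[of UNIV] continuous_on_angle]) auto
  qed (use supp_pos[THEN less_imp_le] g(2) in simp)
  finally show ?thesis .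
qed

text \<open>By \<open>surface_area_measure_eq_distr\<close> the left-hand side is the integral of \<open>g\<close> against the
  surface area measure, so for a support function \<open>g\<close> this is twice the mixed area.\<close>

lemma integral_angle:
  assumes g: "\<And>x. (g has_real_derivative g' x) (at x)" "continuous_on UNIV g'"
    and per: "g (2 * pi) = g 0"
  shows "integral {arclen 0..arclen (2 * pi)} (\<lambda>s. g (angle s)) = integral {0..2 * pi} (\<lambda>\<theta>. g \<theta> * supp \<theta> - g' \<theta> * dsupp \<theta>)"
proof -
  have cg: "continuous_on S g" for S
    using g(1) by (meson DERIV_continuous_on has_field_derivative_at_within)
  have cg': "continuous_on S g'" for S using g(2) by (rule continuous_on_subset) simp
  \<comment> \<open>\<open>H\<close> is the differentiable summand of \<open>arclen\<close> and
    allows ordinary integration by parts; the summand \<open>dsupp\<close> is kept as it is.\<close>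
  define H where "H \<theta> = integral {0..\<theta>} supp" for \<theta>
  have cH: "continuous_on {0..2 * pi} H"
    unfolding H_def[abs_def] by (intro DERIV_continuous_on[OF DERIV_integral_supp]) auto
  have "((\<lambda>\<theta>. g' \<theta> * H \<theta> + g \<theta> * supp \<theta>) has_integral g (2 * pi) * H (2 * pi) - g 0 * H 0) {0..2 * pi}"
  proof (rule fundamental_theorem_of_calculus)
    fix \<theta> :: real assume \<theta>: "\<theta> \<in> {0..2 * pi}"
    have "(H has_real_derivative supp \<theta>) (at \<theta> within {0..2 * pi})"
      unfolding H_def[abs_def] by (rule DERIV_integral_supp[OF order_refl \<theta>])
    then show "((\<lambda>\<theta>. g \<theta> * H \<theta>) has_vector_derivative g' \<theta> * H \<theta> + g \<theta> * supp \<theta>) (at \<theta> within {0..2 * pi})"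
      unfolding has_real_derivative_iff_has_vector_derivative[symmetric]
      by (auto intro!: derivative_eq_intros has_field_derivative_at_within[OF g(1)])
  qed simp
  then have H: "integral {0..2 * pi} (\<lambda>\<theta>. g' \<theta> * H \<theta> + g \<theta> * supp \<theta>) = g (2 * pi) * H (2 * pi) - g 0 * H 0"
    by (rule integral_unique)
  have "integral {0..2 * pi} (\<lambda>\<theta>. g' \<theta> * arclen \<theta>)
      = integral {0..2 * pi} (\<lambda>\<theta>. (g' \<theta> * H \<theta> + g \<theta> * supp \<theta>) - (g \<theta> * supp \<theta> - g' \<theta> * dsupp \<theta>))"
    by (simp add: arclen_def H_def algebra_simps)
  also have "\<dots> = g (2 * pi) * H (2 * pi) - g 0 * H 0 - integral {0..2 * pi} (\<lambda>\<theta>. g \<theta> * supp \<theta> - g' \<theta> * dsupp \<theta>)"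
    unfolding H[symmetric]
    by (intro integral_diff integrable_continuous_real continuous_intros cg cg' cH continuous_on_supp continuous_on_dsupp)
  finally have "integral {0..2 * pi} (\<lambda>\<theta>. g \<theta> * supp \<theta> - g' \<theta> * dsupp \<theta>)
      = g (2 * pi) * H (2 * pi) - g 0 * H 0 - integral {0..2 * pi} (\<lambda>\<theta>. g' \<theta> * arclen \<theta>)" by simp
  moreover have "integral {arclen 0..arclen (2 * pi)} (\<lambda>s. g (angle s)) =
      g (2 * pi) * arclen (2 * pi) - g 0 * arclen 0 - integral {0..2 * pi} (\<lambda>\<theta>. g' \<theta> * arclen \<theta>)"
    using arclen_mono
    by (intro integral_compose_inverse continuous_on_arclen continuous_on_angle angle_arclen g mono_onI) auto
  \<comment> \<open>The terms with \<open>H\<close> cancel, and the remaining boundary terms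
    \<open>g * dsupp\<close> agree at both ends by periodicity.\<close>
  ultimately show ?thesis
    using per dsupp_periodic[of 0] by (simp add: arclen_def H_def algebra_simps)
qed

end

subsection \<open>Blaschke--Bonnesen inequality and uniqueness\<close>

text \<open>Seen from \<open>\<beta>\<close>, the angle of \<open>u\<close> is the arcsine of its
  tangential coordinate; the nonnegative radial coordinate selects the right sign of the
  cosine.\<close>

lemma half_sphere_circle_pointE:
  assumes u: "u \<in> sphere 0 1" and pos: "circle_point \<beta> \<bullet> u \<ge> 0"
  obtains x where "x \<in> {\<beta> - pi / 2..\<beta> + pi / 2}" "u = circle_point x"
proof -
  define c s where "c = circle_point \<beta> \<bullet> u" and "s = circle_tangent \<beta> \<bullet> u"
  have "c * c + s * s = 1"
    using u inner_circle_decomposition[of u u \<beta>] by (simp add: c_def s_def dot_square_norm)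
  then have cs: "s\<^sup>2 \<le> 1" "1 - s\<^sup>2 = c\<^sup>2" by (simp_all add: power2_eq_square algebra_simps) (smt (verit) zero_le_square)
  then have s1: "-1 \<le> s" "s \<le> 1" by (simp_all add: abs_square_le_1 abs_le_iff)
  have "cos (arcsin s) = c" using s1 cs(2) pos by (simp add: cos_arcsin c_def)
  moreover have "sin (arcsin s) = s" using s1 by simp
  moreover have "circle_point \<beta> \<bullet> circle_point (\<beta> + arcsin s) = cos (arcsin s)"
    by (simp add: circle_point_inner_circle_point)
  moreover have "circle_tangent \<beta> \<bullet> circle_point (\<beta> + arcsin s) = sin (arcsin s)"
    by (subst inner_commute) (simp add: circle_point_inner_circle_tangent)
  ultimately have "z \<bullet> u = z \<bullet> circle_point (\<beta> + arcsin s)" for z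
    unfolding inner_circle_decomposition[of z _ \<beta>] by (simp add: c_def s_def)
  then have "u = circle_point (\<beta> + arcsin s)" by (meson vector_eq_ldot)
  moreover have "\<beta> + arcsin s \<in> {\<beta> - pi / 2..\<beta> + pi / 2}" using arcsin_bounded[OF s1] by auto
  ultimately show thesis using that by blast
qed

section \<open>Areas and the quadratic form of a pair in dilation position\<close>

locale dilation_pair = K: planar_body K + L: planar_body L for K L +
  assumes dil: "dilation_position K L"
begin

text \<open>Twice the area of \<open>K - t L\<close>, formally.\<close>

definition wirtinger_form :: "real \<Rightarrow> real" where
  "wirtinger_form t = integral {0..2 * pi} (\<lambda>\<theta>. (K.supp \<theta> - t * L.supp \<theta>)\<^sup>2 - (K.dsupp \<theta> - t * L.dsupp \<theta>)\<^sup>2)"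

text \<open>The support function formula for twice the area, with the second derivative in
  \<open>h (h + h'')\<close> integrated by parts. \<open>mixed_area2\<close> below is its
  polarisation.\<close>

definition areaK2 :: real where
  "areaK2 = integral {0..2 * pi} (\<lambda>\<theta>. K.supp \<theta> * K.supp \<theta> - K.dsupp \<theta> * K.dsupp \<theta>)"

definition areaL2 :: real where
  "areaL2 = integral {0..2 * pi} (\<lambda>\<theta>. L.supp \<theta> * L.supp \<theta> - L.dsupp \<theta> * L.dsupp \<theta>)"

definition mixed_area2 :: real where
  "mixed_area2 = integral {0..2 * pi} (\<lambda>\<theta>. K.supp \<theta> * L.supp \<theta> - K.dsupp \<theta> * L.dsupp \<theta>)"

lemma wirtinger_form_eq: "wirtinger_form t = areaK2 - 2 * t * mixed_area2 + t\<^sup>2 * areaL2"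
proof -
  have "((\<lambda>\<theta>. (K.supp \<theta> * K.supp \<theta> - K.dsupp \<theta> * K.dsupp \<theta>)
      - 2 * t * (K.supp \<theta> * L.supp \<theta> - K.dsupp \<theta> * L.dsupp \<theta>)
      + t\<^sup>2 * (L.supp \<theta> * L.supp \<theta> - L.dsupp \<theta> * L.dsupp \<theta>))
    has_integral (areaK2 - 2 * t * mixed_area2 + t\<^sup>2 * areaL2)) {0..2 * pi}"
    unfolding areaK2_def areaL2_def mixed_area2_def
    by (intro has_integral_add has_integral_diff has_integral_mult_right integrable_integral
        integrable_continuous_real continuous_intros K.continuous_on_supp K.continuous_on_dsupp
        L.continuous_on_supp L.continuous_on_dsupp)
  then show ?thesis
    unfolding wirtinger_form_def by (intro integral_unique) (simp add: power2_eq_square algebra_simps)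
qed

lemmas contact_assms = K.compact K.convex K.zero_interior L.compact L.convex L.zero_interior dil

lemma wirtinger_form_nonpos:
  assumes zeros: "\<And>v. v \<in> sphere 0 1 \<Longrightarrow> \<exists>u\<in>sphere 0 1. v \<bullet> u \<ge> 0 \<and> support_fun K u - t * support_fun L u = 0"
  shows "wirtinger_form t \<le> 0"
  unfolding wirtinger_form_def
proof (rule wirtinger_periodic)
  show "\<exists>x\<in>{\<alpha>..\<alpha> + pi}. K.supp x - t * L.supp x = 0" for \<alpha>
  proof -
    \<comment> \<open>The half circle from \<open>\<alpha>\<close> to \<open>\<alpha> + pi\<close>
      is centred at \<open>\<alpha> + pi / 2\<close>.\<close>
    obtain u where u: "u \<in> sphere 0 1" "circle_point (\<alpha> + pi / 2) \<bullet> u \<ge> 0" "support_fun K u - t * support_fun L u = 0"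
      using zeros[of "circle_point (\<alpha> + pi / 2)"] by auto
    obtain x where "x \<in> {\<alpha> + pi / 2 - pi / 2..\<alpha> + pi / 2 + pi / 2}" "u = circle_point x"
      using half_sphere_circle_pointE[OF u(1,2)] .
    then show ?thesis using u(3) by (intro bexI[of _ x]) (auto simp: K.supp_def L.supp_def)
  qed
  show "((\<lambda>\<theta>. K.supp \<theta> - t * L.supp \<theta>) has_real_derivative K.dsupp x - t * L.dsupp x) (at x)" for x
    by (auto intro!: derivative_eq_intros K.DERIV_supp L.DERIV_supp)
  show "continuous_on UNIV (\<lambda>\<theta>. K.dsupp \<theta> - t * L.dsupp \<theta>)"
    by (intro continuous_intros K.continuous_on_dsupp L.continuous_on_dsupp)
qed (simp_all add: K.supp_periodic L.supp_periodic K.dsupp_periodic L.dsupp_periodic)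

lemma continuous_on_supp_angle:
  "continuous_on {K.arclen 0..K.arclen (2 * pi)} (\<lambda>s. K.supp (K.angle s))"
  "continuous_on {L.arclen 0..L.arclen (2 * pi)} (\<lambda>s. L.supp (L.angle s))"
  by (rule continuous_on_compose2[OF K.continuous_on_supp[of UNIV] K.continuous_on_angle]
      continuous_on_compose2[OF L.continuous_on_supp[of UNIV] L.continuous_on_angle]; simp)+

text \<open>The defining integrand has no sign. Over arc length, \<open>integral_angle\<close> turns
  it into the integral of the positive continuous function \<open>L.supp\<close>.\<close>

lemma areaL2_pos: "areaL2 > 0"
proof -
  have eq: "integral {L.arclen 0..L.arclen (2 * pi)} (\<lambda>s. L.supp (L.angle s)) = areaL2"
    unfolding areaL2_def
    using L.supp_periodic[of 0] by (intro L.integral_angle L.DERIV_supp L.continuous_on_dsupp) simp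
  have "integral {L.arclen 0..L.arclen (2 * pi)} (\<lambda>s. L.supp (L.angle s)) \<ge> 0"
    using L.supp_pos[THEN less_imp_le]
    by (intro integral_nonneg integrable_continuous_real continuous_on_supp_angle) auto
  moreover have "integral {L.arclen 0..L.arclen (2 * pi)} (\<lambda>s. L.supp (L.angle s)) \<noteq> 0"
  proof
    assume "integral {L.arclen 0..L.arclen (2 * pi)} (\<lambda>s. L.supp (L.angle s)) = 0"
    then have "L.supp (L.angle (L.arclen 0)) = 0"
      using integral_eq_0_iff[OF continuous_on_supp_angle(2) L.arclen_0_less] L.supp_pos[THEN less_imp_le] L.arclen_0_less
      by auto
    then show False using L.supp_pos by (metis less_irrefl)
  qed
  ultimately show ?thesis using eq by simp
qed

text \<open>The Blaschke--Bonnesen inequality: \<open>wirtinger_form\<close> is a convex quadratic polynomial, so the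
  two end cases suffice.\<close>

lemma wirtinger_form_nonpos_between:
  assumes "rel_inradius K L \<le> t" "t \<le> rel_circumradius K L"
  shows "wirtinger_form t \<le> 0"
proof -
  let ?r = "rel_inradius K L" and ?R = "rel_circumradius K L"
  have r: "wirtinger_form ?r \<le> 0"
    by (intro wirtinger_form_nonpos rel_inradius_contact[OF contact_assms])
  have R: "wirtinger_form ?R \<le> 0"
  proof (rule wirtinger_form_nonpos)
    fix v :: "real ^ 2" assume "v \<in> sphere 0 1"
    from rel_circumradius_contact[OF contact_assms this]
    show "\<exists>u\<in>sphere 0 1. v \<bullet> u \<ge> 0 \<and> support_fun K u - ?R * support_fun L u = 0" by force
  qed
  show ?thesis
  proof (cases "?r = ?R")
    case False
    \<comment> \<open>Interpolation of the quadratic at the two radii; the remainder carries the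
      leading coefficient \<open>areaL2\<close>, which is positive.\<close>
    have "(?R - ?r) * wirtinger_form t
       = (?R - t) * wirtinger_form ?r + (t - ?r) * wirtinger_form ?R - areaL2 * ((t - ?r) * (?R - t) * (?R - ?r))"
      unfolding wirtinger_form_eq by (simp add: power2_eq_square algebra_simps)
    also have "\<dots> \<le> 0"
    proof -
      have "(?R - t) * wirtinger_form ?r \<le> 0" "(t - ?r) * wirtinger_form ?R \<le> 0"
        using assms r R by (simp_all add: mult_nonneg_nonpos)
      moreover have "areaL2 * ((t - ?r) * (?R - t) * (?R - ?r)) \<ge> 0"
        using assms areaL2_pos by (intro mult_nonneg_nonneg) auto
      ultimately show ?thesis by linarith
    qed
    finally show ?thesis using False assms by (simp add: mult_le_0_iff)
  qed (use assms r in simp)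
qed

section \<open>Integrating the quotient of the support functions against the cone-volume
  measure\<close>

definition ratio :: "real ^ 2 \<Rightarrow> real" where
  "ratio u = support_fun K u / support_fun L u"

lemma ratio_pos: "u \<in> sphere 0 1 \<Longrightarrow> ratio u > 0"
  unfolding ratio_def
  using support_fun_pos[OF K.compact K.zero_interior] support_fun_pos[OF L.compact L.zero_interior] by simp

lemma continuous_on_ratio: "continuous_on (sphere 0 1) ratio"
proof -
  have "\<forall>u\<in>sphere 0 1. support_fun L u \<noteq> 0"
    using support_fun_pos[OF L.compact L.zero_interior] by force
  then show ?thesis
    unfolding ratio_def[abs_def]
    by (intro continuous_on_divide continuous_on_support_fun K.compact L.compact K.nonempty L.nonempty)
qed

lemma wirtinger_form_ratio:
  assumes u: "u \<in> sphere 0 1" shows "wirtinger_form (ratio u) \<le> 0"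
proof (rule wirtinger_form_nonpos_between)
  have "support_fun L u > 0" using support_fun_pos[OF L.compact L.zero_interior u] .
  then show "rel_inradius K L \<le> ratio u" "ratio u \<le> rel_circumradius K L"
    using rel_inradius_support_le[OF contact_assms, of u] rel_circumradius_support_ge[OF contact_assms, of u]
    by (simp_all add: ratio_def field_simps)
qed

lemma cone_volume_eq_imp_eq:
  assumes eq: "cone_volume_measure K = cone_volume_measure L"
  shows "K = L"
proof -
  \<comment> \<open>\<open>IK g\<close> and \<open>IL g\<close> are the integrals of
    \<open>g\<close> against the two cone-volume measures, written over arc length.\<close>
  define IK where "IK g = integral {K.arclen 0..K.arclen (2 * pi)} (\<lambda>s. K.supp (K.angle s) / 2 * g (circle_point (K.angle s)))"
    for g :: "real ^ 2 \<Rightarrow> real"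
  define IL where "IL g = integral {L.arclen 0..L.arclen (2 * pi)} (\<lambda>s. L.supp (L.angle s) / 2 * g (circle_point (L.angle s)))"
    for g :: "real ^ 2 \<Rightarrow> real"
  have contK: "continuous_on {K.arclen 0..K.arclen (2 * pi)} (\<lambda>s. K.supp (K.angle s) / 2 * g (circle_point (K.angle s)))"
    if "continuous_on (sphere 0 1) g" for g
    using that by (intro continuous_intros continuous_on_supp_angle continuous_on_compose2[OF that]
        continuous_on_compose2[OF continuous_on_circle_point[of UNIV] K.continuous_on_angle]) auto
  have contL: "continuous_on {L.arclen 0..L.arclen (2 * pi)} (\<lambda>s. L.supp (L.angle s) / 2 * g (circle_point (L.angle s)))"
    if "continuous_on (sphere 0 1) g" for g
    using that by (intro continuous_intros continuous_on_supp_angle continuous_on_compose2[OF that]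
        continuous_on_compose2[OF continuous_on_circle_point[of UNIV] L.continuous_on_angle]) auto
  have IK_eq_IL: "IK g = IL g" if g: "continuous_on (sphere 0 1) g" "\<And>u. u \<in> sphere 0 1 \<Longrightarrow> g u \<ge> 0" for g
  proof -
    have "ennreal (IK g) = ennreal (IL g)"
      unfolding IK_def IL_def
      using K.nn_integral_cone_volume_measure[OF g] L.nn_integral_cone_volume_measure[OF g] eq by simp
    moreover have "IK g \<ge> 0"
      unfolding IK_def using g(2) K.supp_pos[THEN less_imp_le]
      by (intro integral_nonneg integrable_continuous_real contK[OF g(1)]) simp
    moreover have "IL g \<ge> 0"
      unfolding IL_def using g(2) L.supp_pos[THEN less_imp_le]
      by (intro integral_nonneg integrable_continuous_real contL[OF g(1)]) simp
    ultimately show ?thesis by simp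
  qed
  have ratio_circle: "ratio (circle_point \<theta>) = K.supp \<theta> / L.supp \<theta>" for \<theta>
    by (simp add: ratio_def K.supp_def L.supp_def)
  have cinv: "continuous_on (sphere 0 1) (\<lambda>u. 1 / ratio u)"
    using ratio_pos by (intro continuous_intros continuous_on_ratio) (metis less_irrefl)
  have perK: "K.supp (2 * pi) = K.supp 0" and perL: "L.supp (2 * pi) = L.supp 0"
    using K.supp_periodic[of 0] L.supp_periodic[of 0] by simp_all
  have K1: "IK (\<lambda>u. 1) = areaK2 / 2"
    using K.integral_angle[OF K.DERIV_supp K.continuous_on_dsupp perK] by (simp add: IK_def areaK2_def)
  have L1: "IL (\<lambda>u. 1) = areaL2 / 2"
    using L.integral_angle[OF L.DERIV_supp L.continuous_on_dsupp perL] by (simp add: IL_def areaL2_def)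
  have area_eq: "areaK2 = areaL2" using IK_eq_IL[of "\<lambda>u. 1"] K1 L1 by simp
  \<comment> \<open>The reciprocal ratio exchanges the weight \<open>K.supp\<close> for
    \<open>L.supp\<close>, so the integral along the boundary of \<open>K\<close> becomes a mixed
    area.\<close>
  have "K.supp \<theta> / 2 * (1 / ratio (circle_point \<theta>)) = L.supp \<theta> / 2" for \<theta>
    using K.supp_pos[of \<theta>] by (simp add: ratio_circle)
  then have Kinv: "IK (\<lambda>u. 1 / ratio u) = mixed_area2 / 2"
    using K.integral_angle[OF L.DERIV_supp L.continuous_on_dsupp perL]
    by (simp add: IK_def mixed_area2_def mult.commute)
  \<comment> \<open>The opposite exchange along the boundary of \<open>L\<close>; equality of the
    measures then carries the value over to \<open>IK\<close>.\<close>
  have "L.supp \<theta> / 2 * ratio (circle_point \<theta>) = K.supp \<theta> / 2" for \<theta>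
    using L.supp_pos[of \<theta>] by (simp add: ratio_circle)
  then have "IL ratio = mixed_area2 / 2"
    using L.integral_angle[OF K.DERIV_supp K.continuous_on_dsupp perK]
    by (simp add: IL_def mixed_area2_def mult.commute)
  then have Krat: "IK ratio = mixed_area2 / 2"
    using IK_eq_IL[OF continuous_on_ratio] ratio_pos[THEN less_imp_le] by simp
  \<comment> \<open>On the sphere this is \<open>- wirtinger_form (ratio u) / ratio u\<close>, by
    equality of the areas, and hence nonnegative.\<close>
  define p where "p u = 2 * mixed_area2 - areaK2 * (1 / ratio u) - areaK2 * ratio u" for u
  have cp: "continuous_on (sphere 0 1) p"
    unfolding p_def[abs_def] by (intro continuous_intros continuous_on_ratio cinv)
  have p_eq: "p u * ratio u = - wirtinger_form (ratio u)" if "u \<in> sphere 0 1" for u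
    using ratio_pos[OF that] area_eq by (simp add: p_def wirtinger_form_eq power2_eq_square algebra_simps)
  have p_nonneg: "p u \<ge> 0" if "u \<in> sphere 0 1" for u
    using p_eq[OF that] wirtinger_form_ratio[OF that] ratio_pos[OF that]
    by (simp add: zero_le_mult_iff flip: neg_0_le_iff_le) (smt (verit) mult_neg_pos)
  have "IK p = 2 * mixed_area2 * IK (\<lambda>u. 1) - areaK2 * IK (\<lambda>u. 1 / ratio u) - areaK2 * IK ratio"
  proof -
    have "((\<lambda>s. 2 * mixed_area2 * (K.supp (K.angle s) / 2 * 1)
         - areaK2 * (K.supp (K.angle s) / 2 * (1 / ratio (circle_point (K.angle s))))
         - areaK2 * (K.supp (K.angle s) / 2 * ratio (circle_point (K.angle s))))
       has_integral (2 * mixed_area2 * IK (\<lambda>u. 1) - areaK2 * IK (\<lambda>u. 1 / ratio u) - areaK2 * IK ratio))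
       {K.arclen 0..K.arclen (2 * pi)}"
      unfolding IK_def
      by (intro has_integral_diff has_integral_mult_right integrable_integral integrable_continuous_real
          contK cinv continuous_on_ratio continuous_on_const)
    then show ?thesis unfolding IK_def[of p] p_def by (intro integral_unique) (simp add: algebra_simps)
  qed
  \<comment> \<open>The three terms are \<open>mixed_area2 * areaK2\<close> and twice minus one half
    of it. A nonnegative continuous integrand with vanishing integral is zero.\<close>
  then have "IK p = 0" using K1 Kinv Krat by (simp add: algebra_simps)
  then have "\<forall>s\<in>{K.arclen 0..K.arclen (2 * pi)}. K.supp (K.angle s) / 2 * p (circle_point (K.angle s)) = 0"
    unfolding IK_def
    using p_nonneg K.supp_pos[THEN less_imp_le]
    by (subst (asm) integral_eq_0_iff[OF contK[OF cp] K.arclen_0_less]) auto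
  then have p0: "p (circle_point (K.angle s)) = 0" if "s \<in> {K.arclen 0..K.arclen (2 * pi)}" for s
    using K.supp_pos that by (metis divide_eq_0_iff less_irrefl mult_eq_0_iff zero_neq_numeral)
  have p_zero: "p u = 0" if u: "u \<in> sphere 0 1" for u
  proof -
    obtain \<theta> where \<theta>: "0 \<le> \<theta>" "\<theta> < 2 * pi" "u = circle_point \<theta>" using sphere_circle_pointE[OF u] .
    then have "K.arclen \<theta> \<in> {K.arclen 0..K.arclen (2 * pi)}" "K.angle (K.arclen \<theta>) = \<theta>"
      using K.arclen_mono[of 0 \<theta>] K.arclen_mono[of \<theta> "2 * pi"] K.angle_arclen[of \<theta>] by auto
    then show ?thesis using p0 \<theta>(3) by metis
  qed
  \<comment> \<open>All values are roots of one nonzero polynomial, so the continuous ratio has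
    finite range on a connected line.\<close>
  have "(\<lambda>\<theta>. ratio (circle_point \<theta>)) constant_on UNIV"
  proof (rule continuous_finite_range_constant)
    show "continuous_on UNIV (\<lambda>\<theta>. ratio (circle_point \<theta>))"
      by (rule continuous_on_compose2[OF continuous_on_ratio continuous_on_circle_point]) auto
    have "areaL2 \<noteq> 0" using areaL2_pos by simp
    have "ratio (circle_point \<theta>) \<in> {t. poly [:areaK2, - 2 * mixed_area2, areaL2:] t = 0}" for \<theta>
      using p_eq[of "circle_point \<theta>"] p_zero[of "circle_point \<theta>"]
      by (simp add: wirtinger_form_eq power2_eq_square algebra_simps)
    then have "range (\<lambda>\<theta>. ratio (circle_point \<theta>)) \<subseteq> {t. poly [:areaK2, - 2 * mixed_area2, areaL2:] t = 0}"
      by blast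
    moreover have "finite \<dots>" using \<open>areaL2 \<noteq> 0\<close> by (intro poly_roots_finite) simp
    ultimately show "finite (range (\<lambda>\<theta>. ratio (circle_point \<theta>)))" by (rule finite_subset)
  qed simp
  then obtain k where k: "\<And>\<theta>. ratio (circle_point \<theta>) = k" unfolding constant_on_def by auto
  have "k > 0" using ratio_pos[of "circle_point 0"] k by simp
  \<comment> \<open>Both integrals that equal half of \<open>mixed_area2\<close> are now multiples
    of the same area, with factors \<open>k\<close> and \<open>1 / k\<close>.\<close>
  have "k * areaK2 / 2 = mixed_area2 / 2" "1 / k * areaK2 / 2 = mixed_area2 / 2"
    using Krat Kinv K1 by (simp_all add: IK_def k mult.commute)
  then have "k * areaK2 = 1 / k * areaK2" by simp
  then have "k = 1 / k" using areaL2_pos area_eq by (subst (asm) mult_right_cancel) auto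
  then have "k * k = 1" using \<open>k > 0\<close> by (simp add: field_simps)
  then have "k = 1" using \<open>k > 0\<close> square_eq_1_iff[of k] by auto
  have "support_fun K u = support_fun L u" if u: "u \<in> sphere 0 1" for u
  proof -
    obtain \<theta> where "u = circle_point \<theta>" using sphere_circle_pointE[OF u] by blast
    then show ?thesis using k[of \<theta>] \<open>k = 1\<close> support_fun_pos[OF L.compact L.zero_interior u]
      by (simp add: ratio_def)
  qed
  then show ?thesis
    using mem_convex_iff_support_fun[OF K.compact K.convex K.nonempty]
      mem_convex_iff_support_fun[OF L.compact L.convex L.nonempty] by auto
qed

end

theorem theorem2:
  fixes K L :: "(real ^ 2) set"
  assumes "convex_body K" and "convex_body L"
    and "smooth_body K" and "smooth_body L"
    and "strictly_convex K" and "strictly_convex L"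
    and "0 \<in> interior K" and "0 \<in> interior L"
    and "dilation_position K L"
    and "cone_volume_measure K = cone_volume_measure L"
  shows "K = L"
proof -
  interpret dilation_pair K L
    using assms by unfold_locales (auto simp: convex_body_def)
  show ?thesis using assms(10) by (rule cone_volume_eq_imp_eq)
qed

end
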